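(* Let $H$ be a Hopf algebra and let $X$ be a coalgebra on which $H$ acts (on the right), such that the action is compatible with the comultiplication of $X$. Suppose $X$ is a categorical augmented rack with augmentation map $\nu:X\to H$ that is a coalgebra morphism. Let $Y:=X\otimes X$ be equipped with the coalgebra structure inherited from $X$, $$\Delta_Y:=(\mathbb{1}\otimes\tau\otimes\mathbb{1})(\Delta_X\otimes\Delta_X):Y\to Y\otimes Y,$$ and with the right $H$-action $y\cdot h:=y\cdot\Delta_H(h)$, i.e. $(x_1\otimes x_2)\cdot h=(x_1\cdot h^{(1)})\otimes(x_2\cdot h^{(2)})$. Define $\tilde\nu:Y\to H$ by $\tilde\nu:=\mu(\nu\otimes\nu)$, where $\mu$ is the multiplication of $H$. Then $Y$ is a categorical augmented rack with $\tilde\nu$ (that is, over $H$, with augmentation map $\tilde\nu$).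
   Context: Everything is over a unital ring $\mathbb{k}$; tensor products are over $\mathbb{k}$, $\mathbb{1}$ is the identity map, and $\tau(x\otimes y)=y\otimes x$. A Hopf algebra $H$ has multiplication $\mu$ (written as juxtaposition), unit $\eta$, comultiplication $\Delta_H$, counit $\epsilon$ and antipode $S$. Coalgebras are coassociative and counital; Sweedler notation $\Delta(x)=x^{(1)}\otimes x^{(2)}$ is used with summation suppressed. Categorical augmented rack: let $H$ be a Hopf algebra and let $X$ be a coalgebra (comultiplication $\Delta_X$) that is a right $H$-module with action $x\otimes g\mapsto x\cdot g$, such that the action is compatible with the comultiplication: $\Delta_X(x\cdot g)=(x^{(1)}\cdot g^{(1)})\otimes(x^{(2)}\cdot g^{(2)})$ for all $x\in X$, $g\in H$. An augmentation map is a linear map $\nu:X\to H$ that is a coalgebra morphism, meaning $\Delta_H(\nu(x))=(\nu\otimes\nu)(\Delta_X(x))$ for all $x\in X$, and satisfies $\nu(x\cdot g)=S(g^{(1)})\,\nu(x)\,g^{(2)}$ for all $x\in X$, $g\in H$. If there is an augmentation map $\nu$, $X$ is called a categorical augmented rack (over $H$, with augmentation map $\nu$).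
   Formalization: Compatibility of the action on Y with Δ_Y is claimed only for cocommutative H, as it fails otherwise (X=H acting by right multiplication, ν=ε(·)1); the coalgebra and H-module structure of Y and all augmentation-map conditions on ν̃ are proved for every H. *)

theory Defs
  imports "HOL-Algebra.Module" "HOL-Algebra.Coset" "HOL-Algebra.Generated_Groups"
    "HOL-Algebra.Free_Abelian_Groups"
begin

section \<open>Tensor products of modules over a commutative ring\<close>

definition linear_maps ::
  "('k, 'r) ring_scheme \<Rightarrow> ('k, 'a, 'm) module_scheme \<Rightarrow> ('k, 'b, 'n) module_scheme \<Rightarrow> ('a \<Rightarrow> 'b) set"
  where "linear_maps R M N =
    {f \<in> carrier M \<rightarrow> carrier N.
      (\<forall>x\<in>carrier M. \<forall>y\<in>carrier M. f (x \<oplus>\<^bsub>M\<^esub> y) = f x \<oplus>\<^bsub>N\<^esub> f y) \<and>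
      (\<forall>r\<in>carrier R. \<forall>x\<in>carrier M. f (r \<odot>\<^bsub>M\<^esub> x) = r \<odot>\<^bsub>N\<^esub> f x)}"

definition regular_module :: "('k, 'r) ring_scheme \<Rightarrow> ('k, 'k) module"
  where "regular_module R =
    \<lparr>carrier = carrier R, monoid.mult = (\<otimes>\<^bsub>R\<^esub>), monoid.one = \<one>\<^bsub>R\<^esub>,
      ring.zero = \<zero>\<^bsub>R\<^esub>, ring.add = (\<oplus>\<^bsub>R\<^esub>), smult = (\<otimes>\<^bsub>R\<^esub>)\<rparr>"

type_synonym ('a, 'b) tensor = "('a \<times> 'b \<Rightarrow>\<^sub>0 int) set"

definition tensor_free ::
  "('k, 'a, 'm) module_scheme \<Rightarrow> ('k, 'b, 'n) module_scheme \<Rightarrow> ('a \<times> 'b \<Rightarrow>\<^sub>0 int) monoid"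
  where "tensor_free M N = free_Abelian_group (carrier M \<times> carrier N)"

definition tensor_relations ::
  "('k, 'r) ring_scheme \<Rightarrow> ('k, 'a, 'm) module_scheme \<Rightarrow> ('k, 'b, 'n) module_scheme \<Rightarrow>
    ('a \<times> 'b \<Rightarrow>\<^sub>0 int) set"
  where "tensor_relations R M N = generate (tensor_free M N)
    ({frag_of (a \<oplus>\<^bsub>M\<^esub> a', b) - frag_of (a, b) - frag_of (a', b) | a a' b.
        a \<in> carrier M \<and> a' \<in> carrier M \<and> b \<in> carrier N} \<union>
     {frag_of (a, b \<oplus>\<^bsub>N\<^esub> b') - frag_of (a, b) - frag_of (a, b') | a b b'.
        a \<in> carrier M \<and> b \<in> carrier N \<and> b' \<in> carrier N} \<union>
     {frag_of (r \<odot>\<^bsub>M\<^esub> a, b) - frag_of (a, r \<odot>\<^bsub>N\<^esub> b) | r a b.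
        r \<in> carrier R \<and> a \<in> carrier M \<and> b \<in> carrier N})"

definition pure_tensor ::
  "('k, 'r) ring_scheme \<Rightarrow> ('k, 'a, 'm) module_scheme \<Rightarrow> ('k, 'b, 'n) module_scheme \<Rightarrow>
    'a \<Rightarrow> 'b \<Rightarrow> ('a, 'b) tensor"
  where "pure_tensor R M N a b = tensor_relations R M N #>\<^bsub>tensor_free M N\<^esub> frag_of (a, b)"

text \<open>The module M \<otimes> N: the free abelian group on the pairs, modulo the bilinearity and balancing
  relations, with r (a \<otimes> b) = (r a) \<otimes> b. The multiplicative fields of the record carry no
  meaning here; they are filled in for algebras by \<open>tensor_algebra\<close> below.\<close>

definition tensor_module ::
  "('k, 'r) ring_scheme \<Rightarrow> ('k, 'a, 'm) module_scheme \<Rightarrow> ('k, 'b, 'n) module_scheme \<Rightarrow>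
    ('k, ('a, 'b) tensor) module"
  where "tensor_module R M N =
    (let Q = tensor_free M N Mod tensor_relations R M N in
     \<lparr>carrier = carrier Q, monoid.mult = undefined, monoid.one = undefined,
      ring.zero = \<one>\<^bsub>Q\<^esub>, ring.add = (\<otimes>\<^bsub>Q\<^esub>),
      smult = (\<lambda>r t. \<Union>c\<in>t. tensor_relations R M N #>\<^bsub>tensor_free M N\<^esub>
                 frag_extend (\<lambda>(a, b). frag_of (r \<odot>\<^bsub>M\<^esub> a, b)) c)\<rparr>)"

text \<open>For an R-bilinear map f from M and N to P, \<open>tensor_lift P f\<close> is the linear map
  M \<otimes> N \<rightarrow> P induced by the universal property. It is computed on a representative of the coset;
  the result does not depend on the choice because f is bilinear. Applied to a comultiplication it
  plays the role of Sweedler notation: \<open>tensor_lift P f (\<Delta> x)\<close> is the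
  sum of f x(1) x(2).\<close>

definition tensor_lift ::
  "('p, 'q) ring_scheme \<Rightarrow> ('a \<Rightarrow> 'b \<Rightarrow> 'p) \<Rightarrow> ('a, 'b) tensor \<Rightarrow> 'p"
  where "tensor_lift P f t =
    (let c = (SOME c. c \<in> t) in
     finsum P (\<lambda>z. add_pow P (Poly_Mapping.lookup c z) (f (fst z) (snd z))) (Poly_Mapping.keys c))"

text \<open>\<open>tensor_map R P Q f g\<close> is f \<otimes> g, with values in P \<otimes> Q.\<close>

definition tensor_map ::
  "('k, 'r) ring_scheme \<Rightarrow> ('k, 'c, 'm) module_scheme \<Rightarrow> ('k, 'd, 'n) module_scheme \<Rightarrow>
    ('a \<Rightarrow> 'c) \<Rightarrow> ('b \<Rightarrow> 'd) \<Rightarrow> ('a, 'b) tensor \<Rightarrow> ('c, 'd) tensor"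
  where "tensor_map R P Q f g =
    tensor_lift (tensor_module R P Q) (\<lambda>a b. pure_tensor R P Q (f a) (g b))"

text \<open>\<open>tensor_map2 R P Q f g\<close> sends a \<otimes> b and c \<otimes> d to f a c \<otimes> g b d in P \<otimes> Q.\<close>

definition tensor_map2 ::
  "('k, 'r) ring_scheme \<Rightarrow> ('k, 'e, 'm) module_scheme \<Rightarrow> ('k, 'f, 'n) module_scheme \<Rightarrow>
    ('a \<Rightarrow> 'c \<Rightarrow> 'e) \<Rightarrow> ('b \<Rightarrow> 'd \<Rightarrow> 'f) \<Rightarrow>
    ('a, 'b) tensor \<Rightarrow> ('c, 'd) tensor \<Rightarrow> ('e, 'f) tensor"
  where "tensor_map2 R P Q f g s t =
    tensor_lift (tensor_module R P Q)
      (\<lambda>a b. tensor_lift (tensor_module R P Q) (\<lambda>c d. pure_tensor R P Q (f a c) (g b d)) t) s"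

definition tensor_assoc ::
  "('k, 'r) ring_scheme \<Rightarrow> ('k, 'a, 'm) module_scheme \<Rightarrow> ('k, 'b, 'n) module_scheme \<Rightarrow>
    ('k, 'c, 'o) module_scheme \<Rightarrow> (('a, 'b) tensor, 'c) tensor \<Rightarrow> ('a, ('b, 'c) tensor) tensor"
  where "tensor_assoc R A B C =
    (let T = tensor_module R A (tensor_module R B C) in
     tensor_lift T (\<lambda>s c. tensor_lift T
       (\<lambda>a b. pure_tensor R A (tensor_module R B C) a (pure_tensor R B C b c)) s))"

definition tensor_swap ::
  "('k, 'r) ring_scheme \<Rightarrow> ('k, 'a, 'm) module_scheme \<Rightarrow> ('k, 'b, 'n) module_scheme \<Rightarrow>
    ('a, 'b) tensor \<Rightarrow> ('b, 'a) tensor"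
  where "tensor_swap R A B =
    tensor_lift (tensor_module R B A) (\<lambda>a b. pure_tensor R B A b a)"

text \<open>The map 1 \<otimes> \<tau> \<otimes> 1, bracketed as
  (A \<otimes> B) \<otimes> (C \<otimes> D) \<rightarrow> (A \<otimes> C) \<otimes> (B \<otimes> D).\<close>

definition tensor_mid_swap ::
  "('k, 'r) ring_scheme \<Rightarrow> ('k, 'a, 'm) module_scheme \<Rightarrow> ('k, 'b, 'n) module_scheme \<Rightarrow>
    ('k, 'c, 'o) module_scheme \<Rightarrow> ('k, 'd, 'p) module_scheme \<Rightarrow>
    (('a, 'b) tensor, ('c, 'd) tensor) tensor \<Rightarrow> (('a, 'c) tensor, ('b, 'd) tensor) tensor"
  where "tensor_mid_swap R A B C D =
    (let AC = tensor_module R A C; BD = tensor_module R B D in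
     tensor_lift (tensor_module R AC BD)
       (tensor_map2 R AC BD (pure_tensor R A C) (pure_tensor R B D)))"

definition tensor_algebra ::
  "('k, 'r) ring_scheme \<Rightarrow> ('k, 'a, 'm) module_scheme \<Rightarrow> ('k, 'b, 'n) module_scheme \<Rightarrow>
    ('k, ('a, 'b) tensor) module"
  where "tensor_algebra R A B = (tensor_module R A B)
    \<lparr>monoid.mult := tensor_map2 R A B (\<otimes>\<^bsub>A\<^esub>) (\<otimes>\<^bsub>B\<^esub>),
     monoid.one := pure_tensor R A B \<one>\<^bsub>A\<^esub> \<one>\<^bsub>B\<^esub>\<rparr>"


section \<open>Coalgebras, Hopf algebras and their modules\<close>

locale coalgebra = module R C
  for R :: "'k ring" and C :: "('k, 'c) module" +
  fixes \<Delta> :: "'c \<Rightarrow> ('c, 'c) tensor" and \<epsilon> :: "'c \<Rightarrow> 'k"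
  assumes comult_linear: "\<Delta> \<in> linear_maps R C (tensor_module R C C)"
    and counit_linear: "\<epsilon> \<in> linear_maps R C (regular_module R)"
    and coassoc: "x \<in> carrier C \<Longrightarrow>
      tensor_assoc R C C C (tensor_map R (tensor_module R C C) C \<Delta> id (\<Delta> x)) =
      tensor_map R C (tensor_module R C C) id \<Delta> (\<Delta> x)"
    and counit_left: "x \<in> carrier C \<Longrightarrow> tensor_lift C (\<lambda>a b. \<epsilon> a \<odot>\<^bsub>C\<^esub> b) (\<Delta> x) = x"
    and counit_right: "x \<in> carrier C \<Longrightarrow> tensor_lift C (\<lambda>a b. \<epsilon> b \<odot>\<^bsub>C\<^esub> a) (\<Delta> x) = x"

text \<open>The library locale \<open>algebra\<close> is restricted to commutative algebras.\<close>

locale noncomm_algebra = module R A + ring A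
  for R :: "'k ring" and A :: "('k, 'a) module" +
  assumes smult_mult_left: "\<lbrakk>r \<in> carrier R; x \<in> carrier A; y \<in> carrier A\<rbrakk> \<Longrightarrow>
      (r \<odot>\<^bsub>A\<^esub> x) \<otimes>\<^bsub>A\<^esub> y = r \<odot>\<^bsub>A\<^esub> (x \<otimes>\<^bsub>A\<^esub> y)"
    and smult_mult_right: "\<lbrakk>r \<in> carrier R; x \<in> carrier A; y \<in> carrier A\<rbrakk> \<Longrightarrow>
      x \<otimes>\<^bsub>A\<^esub> (r \<odot>\<^bsub>A\<^esub> y) = r \<odot>\<^bsub>A\<^esub> (x \<otimes>\<^bsub>A\<^esub> y)"

locale hopf_algebra = noncomm_algebra R H + coalgebra R H \<Delta>\<^sub>H \<epsilon>\<^sub>H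
  for R :: "'k ring" and H :: "('k, 'h) module"
    and \<Delta>\<^sub>H :: "'h \<Rightarrow> ('h, 'h) tensor" and \<epsilon>\<^sub>H :: "'h \<Rightarrow> 'k" +
  fixes S :: "'h \<Rightarrow> 'h"
  assumes comult_ring_hom: "\<Delta>\<^sub>H \<in> ring_hom H (tensor_algebra R H H)"
    and counit_ring_hom: "\<epsilon>\<^sub>H \<in> ring_hom H R"
    and antipode_linear: "S \<in> linear_maps R H H"
    and antipode_left: "h \<in> carrier H \<Longrightarrow>
      tensor_lift H (\<lambda>a b. S a \<otimes>\<^bsub>H\<^esub> b) (\<Delta>\<^sub>H h) = \<epsilon>\<^sub>H h \<odot>\<^bsub>H\<^esub> \<one>\<^bsub>H\<^esub>"
    and antipode_right: "h \<in> carrier H \<Longrightarrow>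
      tensor_lift H (\<lambda>a b. a \<otimes>\<^bsub>H\<^esub> S b) (\<Delta>\<^sub>H h) = \<epsilon>\<^sub>H h \<odot>\<^bsub>H\<^esub> \<one>\<^bsub>H\<^esub>"

definition cocommutative ::
  "'k ring \<Rightarrow> ('k, 'c) module \<Rightarrow> ('c \<Rightarrow> ('c, 'c) tensor) \<Rightarrow> bool"
  where "cocommutative R C \<Delta> \<longleftrightarrow> (\<forall>x\<in>carrier C. tensor_swap R C C (\<Delta> x) = \<Delta> x)"

locale right_module = noncomm_algebra R A + X: module R X
  for R :: "'k ring" and A :: "('k, 'a) module" and X :: "('k, 'x) module" +
  fixes act :: "'x \<Rightarrow> 'a \<Rightarrow> 'x"
  assumes act_linear_left: "g \<in> carrier A \<Longrightarrow> (\<lambda>x. act x g) \<in> linear_maps R X X"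
    and act_linear_right: "x \<in> carrier X \<Longrightarrow> act x \<in> linear_maps R A X"
    and act_one: "x \<in> carrier X \<Longrightarrow> act x \<one>\<^bsub>A\<^esub> = x"
    and act_mult: "\<lbrakk>x \<in> carrier X; g \<in> carrier A; h \<in> carrier A\<rbrakk> \<Longrightarrow>
      act x (g \<otimes>\<^bsub>A\<^esub> h) = act (act x g) h"


section \<open>Categorical augmented racks\<close>

locale coalgebra_with_action =
  hopf_algebra R H \<Delta>\<^sub>H \<epsilon>\<^sub>H S + X: coalgebra R X \<Delta>\<^sub>X \<epsilon>\<^sub>X + right_module R H X act
  for R :: "'k ring"
    and H :: "('k, 'h) module" and \<Delta>\<^sub>H and \<epsilon>\<^sub>H and S :: "'h \<Rightarrow> 'h"
    and X :: "('k, 'x) module" and \<Delta>\<^sub>X and \<epsilon>\<^sub>X and act :: "'x \<Rightarrow> 'h \<Rightarrow> 'x"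

text \<open>Compatibility of the action with the comultiplication,
  \<Delta>(x g) = (x(1) g(1)) \<otimes> (x(2) g(2)), is not part of
  \<open>coalgebra_with_action\<close>; it is the axiom of \<open>categorical_augmented_rack\<close>.
  It is kept separate because the diagonal action on X \<otimes> X inherits it only when H is
  cocommutative: for X = H with right multiplication, it holds on X \<otimes> X iff H is cocommutative.
  As a coalgebra morphism, \<nu> is only required to respect comultiplications, not counits.\<close>

locale augmentation_map = coalgebra_with_action R H \<Delta>\<^sub>H \<epsilon>\<^sub>H S X \<Delta>\<^sub>X \<epsilon>\<^sub>X act
  for R :: "'k ring"
    and H :: "('k, 'h) module" and \<Delta>\<^sub>H and \<epsilon>\<^sub>H and S :: "'h \<Rightarrow> 'h"
    and X :: "('k, 'x) module" and \<Delta>\<^sub>X and \<epsilon>\<^sub>X and act :: "'x \<Rightarrow> 'h \<Rightarrow> 'x" +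
  fixes \<nu> :: "'x \<Rightarrow> 'h"
  assumes aug_linear: "\<nu> \<in> linear_maps R X H"
    and aug_comult: "x \<in> carrier X \<Longrightarrow> \<Delta>\<^sub>H (\<nu> x) = tensor_map R H H \<nu> \<nu> (\<Delta>\<^sub>X x)"
    and aug_act: "\<lbrakk>x \<in> carrier X; g \<in> carrier H\<rbrakk> \<Longrightarrow>
      \<nu> (act x g) = tensor_lift H (\<lambda>g\<^sub>1 g\<^sub>2. S g\<^sub>1 \<otimes>\<^bsub>H\<^esub> \<nu> x \<otimes>\<^bsub>H\<^esub> g\<^sub>2) (\<Delta>\<^sub>H g)"

locale categorical_augmented_rack =
  augmentation_map R H \<Delta>\<^sub>H \<epsilon>\<^sub>H S X \<Delta>\<^sub>X \<epsilon>\<^sub>X act \<nu>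
  for R :: "'k ring"
    and H :: "('k, 'h) module" and \<Delta>\<^sub>H and \<epsilon>\<^sub>H and S :: "'h \<Rightarrow> 'h"
    and X :: "('k, 'x) module" and \<Delta>\<^sub>X and \<epsilon>\<^sub>X and act :: "'x \<Rightarrow> 'h \<Rightarrow> 'x"
    and \<nu> :: "'x \<Rightarrow> 'h" +
  assumes act_compatible: "\<lbrakk>x \<in> carrier X; g \<in> carrier H\<rbrakk> \<Longrightarrow>
      \<Delta>\<^sub>X (act x g) = tensor_map2 R X X act act (\<Delta>\<^sub>X x) (\<Delta>\<^sub>H g)"


section \<open>The structure on X \<otimes> X\<close>

definition square_comult ::
  "'k ring \<Rightarrow> ('k, 'x) module \<Rightarrow> ('x \<Rightarrow> ('x, 'x) tensor) \<Rightarrow>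
    ('x, 'x) tensor \<Rightarrow> (('x, 'x) tensor, ('x, 'x) tensor) tensor"
  where "square_comult R X \<Delta> y =
    tensor_mid_swap R X X X X (tensor_map R (tensor_module R X X) (tensor_module R X X) \<Delta> \<Delta> y)"

text \<open>\<epsilon> \<otimes> \<epsilon>, followed by R \<otimes> R = R.\<close>

definition square_counit :: "'k ring \<Rightarrow> ('x \<Rightarrow> 'k) \<Rightarrow> ('x, 'x) tensor \<Rightarrow> 'k"
  where "square_counit R \<epsilon> = tensor_lift R (\<lambda>a b. \<epsilon> a \<otimes>\<^bsub>R\<^esub> \<epsilon> b)"

definition square_act ::
  "'k ring \<Rightarrow> ('k, 'x) module \<Rightarrow> ('h \<Rightarrow> ('h, 'h) tensor) \<Rightarrow> ('x \<Rightarrow> 'h \<Rightarrow> 'x) \<Rightarrow>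
    ('x, 'x) tensor \<Rightarrow> 'h \<Rightarrow> ('x, 'x) tensor"
  where "square_act R X \<Delta>\<^sub>H act y h = tensor_map2 R X X act act y (\<Delta>\<^sub>H h)"

definition square_aug ::
  "'k ring \<Rightarrow> ('k, 'h) module \<Rightarrow> ('x \<Rightarrow> 'h) \<Rightarrow> ('x, 'x) tensor \<Rightarrow> 'h"
  where "square_aug R H \<nu> y = tensor_lift H (\<otimes>\<^bsub>H\<^esub>) (tensor_map R H H \<nu> \<nu> y)"

end

theory Submission
  imports Defs
begin

text \<open>Every identity is linear in the element of \<open>X \<otimes> X\<close>, so it may be checked on pure tensors, where
  iterated \<open>tensor_lift\<close> is Sweedler summation: additive maps move through it, independent sums can
  be exchanged, and coassociativity becomes an identity between iterated sums. The augmentation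
  axiom reduces to \<open>S g(1) v g(2) S g(3) w g(4) = S g(1) v w g(2)\<close>. Compatibility of the diagonal
  action with the comultiplication requires exchanging \<open>g(2)\<close> and \<open>g(3)\<close> in the fourfold coproduct of
  \<open>g\<close>, and this is the one place where cocommutativity enters.\<close>

section \<open>Sums over formal integer combinations\<close>

text \<open>\<open>tensor_lift\<close> evaluates a tensor on one representative picked by
  \<open>SOME\<close>, whatever the summand is, and this divides the tools in two. As long as the
  tensor is fixed, so is its representative: closure, congruence, linearity in a parameter and the
  exchange of two sums hold for every summand with values in the carrier. Evaluation at a pure
  tensor and linearity in the tensor compare different representatives and call for a bilinear
  summand. \<open>frag_finsum\<close> is what remains of \<open>tensor_lift\<close> after the
  choice: it is additive in the formal sum, and for bilinear summands it vanishes on the relations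
  of the tensor product. Threefold tensors get no normal form. An identity between them is used by
  applying an arbitrary multilinear map \<open>F\<close> to both sides, and it is recovered by
  letting \<open>F\<close> be the universal such map. The side conditions, membership and linearity
  in each variable, follow the syntax of the terms, which is why they are left to resolution with
  collections such as \<open>lin\<close>.\<close>

definition frag_finsum :: "('p, 'q) ring_scheme \<Rightarrow> ('a \<Rightarrow> 'p) \<Rightarrow> ('a \<Rightarrow>\<^sub>0 int) \<Rightarrow> 'p"
  where "frag_finsum P f c =
    finsum P (\<lambda>z. add_pow P (Poly_Mapping.lookup c z) (f z)) (Poly_Mapping.keys c)"

context abelian_group
begin

lemma add_pow_int_zero: "add_pow G (0::int) x = \<zero>"
  by (simp add: add_pow_def)

text \<open>The support of a sum of formal combinations can shrink by cancellation. Over a fixed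
  finite set that contains all supports, additivity becomes a termwise law of integer
  multiples.\<close>

lemma frag_finsum_superset:
  assumes "finite B" "Poly_Mapping.keys c \<subseteq> B" "f \<in> B \<rightarrow> carrier G"
  shows "frag_finsum G f c = (\<Oplus>z\<in>B. [Poly_Mapping.lookup c z] \<cdot> f z)"
  unfolding frag_finsum_def
  using assms by (intro add.finprod_mono_neutral_cong_left)
    (auto simp: in_keys_iff Pi_iff add.int_pow_closed add_pow_int_zero)

lemma frag_finsum_closed:
  assumes "Poly_Mapping.keys c \<subseteq> B" "f \<in> B \<rightarrow> carrier G"
  shows "frag_finsum G f c \<in> carrier G"
  using assms unfolding frag_finsum_def
  by (intro finsum_closed) (auto simp: Pi_iff subset_iff add.int_pow_closed)

lemma frag_finsum_add:
  assumes "Poly_Mapping.keys c \<subseteq> B" "Poly_Mapping.keys d \<subseteq> B" "f \<in> B \<rightarrow> carrier G"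
  shows "frag_finsum G f (c + d) = frag_finsum G f c \<oplus> frag_finsum G f d"
proof -
  define K where "K = Poly_Mapping.keys c \<union> Poly_Mapping.keys d"
  have K: "finite K" "f \<in> K \<rightarrow> carrier G" "Poly_Mapping.keys c \<subseteq> K" "Poly_Mapping.keys d \<subseteq> K"
    "Poly_Mapping.keys (c + d) \<subseteq> K"
    using assms Poly_Mapping.keys_add[of c d] by (auto simp: K_def)
  have "frag_finsum G f (c + d)
      = (\<Oplus>z\<in>K. [Poly_Mapping.lookup c z] \<cdot> f z \<oplus> [Poly_Mapping.lookup d z] \<cdot> f z)"
    unfolding frag_finsum_superset[OF K(1,5,2)]
    using K(2) by (intro finsum_cong')
      (auto simp: lookup_add Pi_iff add.int_pow_mult add.int_pow_closed)
  also have "\<dots> = frag_finsum G f c \<oplus> frag_finsum G f d"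
    unfolding frag_finsum_superset[OF K(1,3,2)] frag_finsum_superset[OF K(1,4,2)]
    using K(2) by (intro finsum_addf) (auto simp: Pi_iff add.int_pow_closed)
  finally show ?thesis .
qed

lemma frag_finsum_zero [simp]: "frag_finsum G f 0 = \<zero>"
  by (simp add: frag_finsum_def)

lemma frag_finsum_of [simp]: "f x \<in> carrier G \<Longrightarrow> frag_finsum G f (frag_of x) = f x"
  by (subst frag_finsum_superset[of "{x}"]) (auto simp: add.int_pow_1)

text \<open>Differences matter because \<open>frag_induction\<close> builds formal combinations from
  generators by subtraction.\<close>

lemma frag_finsum_diff:
  assumes "Poly_Mapping.keys c \<subseteq> B" "Poly_Mapping.keys d \<subseteq> B" "f \<in> B \<rightarrow> carrier G"
  shows "frag_finsum G f (c - d) = frag_finsum G f c \<ominus> frag_finsum G f d"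
proof -
  have keys: "Poly_Mapping.keys (c - d) \<subseteq> B"
    using assms keys_diff[of c d] by blast
  have "frag_finsum G f c = frag_finsum G f ((c - d) + d)"
    by simp
  also have "\<dots> = frag_finsum G f (c - d) \<oplus> frag_finsum G f d"
    by (intro frag_finsum_add[where B = B] keys assms)
  finally have *: "frag_finsum G f c = frag_finsum G f (c - d) \<oplus> frag_finsum G f d" .
  have "frag_finsum G f (c - d) \<in> carrier G" "frag_finsum G f d \<in> carrier G"
    using keys assms by (auto intro: frag_finsum_closed)
  then show ?thesis
    unfolding * by (simp add: a_minus_def a_assoc r_neg)
qed

end

lemma tensor_lift_eq_frag_finsum:
  "tensor_lift P f t = frag_finsum P (\<lambda>z. f (fst z) (snd z)) (SOME c. c \<in> t)"
  by (simp add: tensor_lift_def frag_finsum_def Let_def)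

section \<open>The module of tensors\<close>

locale two_modules = M: module R M + N: module R N
  for R :: "('k, 'r) ring_scheme" (structure)
    and M :: "('k, 'a, 'm) module_scheme" and N :: "('k, 'b, 'n) module_scheme"
begin

abbreviation "pairs \<equiv> carrier M \<times> carrier N"
abbreviation "F \<equiv> tensor_free M N"
abbreviation "T \<equiv> tensor_module R M N"
abbreviation "rel \<equiv> tensor_relations R M N"
abbreviation "cls c \<equiv> rel #>\<^bsub>F\<^esub> c"

lemma carrier_F: "carrier F = {c. Poly_Mapping.keys c \<subseteq> pairs}"
  and mult_F: "x \<otimes>\<^bsub>F\<^esub> y = x + y"
  and one_F: "\<one>\<^bsub>F\<^esub> = 0"
  and inv_F: "Poly_Mapping.keys x \<subseteq> pairs \<Longrightarrow> inv\<^bsub>F\<^esub> x = - x"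
  by (auto simp: tensor_free_def)

section \<open>The subgroup of relations and its cosets\<close>

lemma comm_group_F: "comm_group F"
  unfolding tensor_free_def by (rule abelian_free_Abelian_group)

sublocale F: comm_group F
  by (rule comm_group_F)

text \<open>The generating set inside \<open>tensor_relations\<close>. As a constant it supports
  case analysis by the kind of relation, and with it induction over the generated subgroup.\<close>

definition gens :: "('a \<times> 'b \<Rightarrow>\<^sub>0 int) set" where
  "gens =
    {frag_of (a \<oplus>\<^bsub>M\<^esub> a', b) - frag_of (a, b) - frag_of (a', b) | a a' b.
        a \<in> carrier M \<and> a' \<in> carrier M \<and> b \<in> carrier N} \<union>
     {frag_of (a, b \<oplus>\<^bsub>N\<^esub> b') - frag_of (a, b) - frag_of (a, b') | a b b'.
        a \<in> carrier M \<and> b \<in> carrier N \<and> b' \<in> carrier N} \<union>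
     {frag_of (r \<odot>\<^bsub>M\<^esub> a, b) - frag_of (a, r \<odot>\<^bsub>N\<^esub> b) | r a b.
        r \<in> carrier R \<and> a \<in> carrier M \<and> b \<in> carrier N}"

lemma rel_eq: "rel = generate F gens"
  by (simp add: tensor_relations_def gens_def)

lemma keys_diff_subset:
  fixes c d :: "'x \<Rightarrow>\<^sub>0 int"
  shows "Poly_Mapping.keys c \<subseteq> A \<Longrightarrow> Poly_Mapping.keys d \<subseteq> A \<Longrightarrow> Poly_Mapping.keys (c - d) \<subseteq> A"
  using keys_diff[of c d] by blast

lemma gensI:
  "\<lbrakk>a \<in> carrier M; a' \<in> carrier M; b \<in> carrier N\<rbrakk> \<Longrightarrow>
    frag_of (a \<oplus>\<^bsub>M\<^esub> a', b) - frag_of (a, b) - frag_of (a', b) \<in> gens"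
  "\<lbrakk>a \<in> carrier M; b \<in> carrier N; b' \<in> carrier N\<rbrakk> \<Longrightarrow>
    frag_of (a, b \<oplus>\<^bsub>N\<^esub> b') - frag_of (a, b) - frag_of (a, b') \<in> gens"
  "\<lbrakk>r \<in> carrier R; a \<in> carrier M; b \<in> carrier N\<rbrakk> \<Longrightarrow>
    frag_of (r \<odot>\<^bsub>M\<^esub> a, b) - frag_of (a, r \<odot>\<^bsub>N\<^esub> b) \<in> gens"
  unfolding gens_def by blast+

lemma gensE [consumes 1, case_names left right balanced]:
  assumes "c \<in> gens"
  obtains a a' b where "a \<in> carrier M" "a' \<in> carrier M" "b \<in> carrier N"
      "c = frag_of (a \<oplus>\<^bsub>M\<^esub> a', b) - frag_of (a, b) - frag_of (a', b)"
    | a b b' where "a \<in> carrier M" "b \<in> carrier N" "b' \<in> carrier N"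
      "c = frag_of (a, b \<oplus>\<^bsub>N\<^esub> b') - frag_of (a, b) - frag_of (a, b')"
    | r a b where "r \<in> carrier R" "a \<in> carrier M" "b \<in> carrier N"
      "c = frag_of (r \<odot>\<^bsub>M\<^esub> a, b) - frag_of (a, r \<odot>\<^bsub>N\<^esub> b)"
  using assms unfolding gens_def
  by (elim UnE CollectE exE conjE) (rule that; assumption)+

lemma gens_subset: "gens \<subseteq> carrier F"
proof
  fix c assume "c \<in> gens"
  then have "Poly_Mapping.keys c \<subseteq> pairs"
  proof (cases rule: gensE)
    case (left a a' b)
    then show ?thesis
      unfolding left(4) by (intro keys_diff_subset) (simp_all only: keys_frag_of, auto)
  next
    case (right a b b')
    then show ?thesis
      unfolding right(4) by (intro keys_diff_subset) (simp_all only: keys_frag_of, auto)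
  next
    case (balanced r a b)
    then show ?thesis
      unfolding balanced(4) by (intro keys_diff_subset) (simp_all only: keys_frag_of, auto)
  qed
  then show "c \<in> carrier F" by (simp add: carrier_F)
qed

lemma subgroup_rel: "subgroup rel F"
  unfolding rel_eq by (intro F.generate_is_subgroup gens_subset)

sublocale rel: normal rel F
  by (intro F.subgroup_imp_normal subgroup_rel)

lemma rel_subset: "c \<in> rel \<Longrightarrow> Poly_Mapping.keys c \<subseteq> pairs"
  using rel.subset carrier_F by auto

lemma rel_zero: "0 \<in> rel"
  using rel.one_closed by (simp add: one_F)

lemma rel_add: "c \<in> rel \<Longrightarrow> d \<in> rel \<Longrightarrow> c + d \<in> rel"
  using rel.m_closed[of c d] by (simp add: mult_F)

lemma rel_minus: "c \<in> rel \<Longrightarrow> - c \<in> rel"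
  using rel.m_inv_closed[of c] by (simp add: inv_F rel_subset)

lemma rel_diff: "c \<in> rel \<Longrightarrow> d \<in> rel \<Longrightarrow> c - d \<in> rel"
  using rel_add[of c "- d"] rel_minus[of d] by simp

lemma rel_gens: "c \<in> gens \<Longrightarrow> c \<in> rel"
  unfolding rel_eq by (rule generate.incl)

text \<open>Restates \<open>generate.induct\<close> with the plus and minus of formal sums instead
  of the group operations of \<open>F\<close>; inverses of generators fall under the case
  \<open>minus\<close>.\<close>

lemma rel_induct [consumes 1, case_names zero gen add minus]:
  assumes c: "c \<in> rel"
    and "P 0" and "\<And>c. c \<in> gens \<Longrightarrow> P c"
    and add: "\<And>c d. c \<in> rel \<Longrightarrow> d \<in> rel \<Longrightarrow> P c \<Longrightarrow> P d \<Longrightarrow> P (c + d)"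
    and minus: "\<And>c. c \<in> rel \<Longrightarrow> P c \<Longrightarrow> P (- c)"
  shows "P c"
  using c[unfolded rel_eq]
proof (induction rule: generate.induct)
  case (inv h)
  with gens_subset show ?case
    using minus[OF rel_gens[OF inv]] assms(3)[OF inv] by (subst inv_F) (auto simp: carrier_F)
next
  case (eng h1 h2)
  then show ?case
    using add by (simp add: mult_F rel_eq)
qed (use assms in \<open>auto simp: one_F\<close>)

lemma mem_cls_iff: "Poly_Mapping.keys d \<subseteq> pairs \<Longrightarrow> c \<in> cls d \<longleftrightarrow> c - d \<in> rel"
  unfolding r_coset_def by (auto simp: mult_F) (metis diff_add_cancel)

lemma cls_eq_iff:
  assumes "Poly_Mapping.keys c \<subseteq> pairs" "Poly_Mapping.keys d \<subseteq> pairs"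
  shows "cls c = cls d \<longleftrightarrow> c - d \<in> rel"
proof
  assume "cls c = cls d"
  then show "c - d \<in> rel"
    using mem_cls_iff[of d c] mem_cls_iff[of c c] assms rel_zero by auto
next
  assume cd: "c - d \<in> rel"
  show "cls c = cls d"
  proof (rule Set.set_eqI)
    fix x
    have "x - d \<in> rel" if "x - c \<in> rel" using rel_add[OF that cd] by simp
    moreover have "x - c \<in> rel" if "x - d \<in> rel" using rel_diff[OF that cd] by simp
    ultimately show "x \<in> cls c \<longleftrightarrow> x \<in> cls d"
      using assms by (auto simp: mem_cls_iff)
  qed
qed

section \<open>The module structure on classes of formal sums\<close>

lemma carrier_T: "carrier T = {cls c | c. Poly_Mapping.keys c \<subseteq> pairs}"
  by (auto simp: tensor_module_def FactGroup_def RCOSETS_def carrier_F Let_def)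

lemma carrierE:
  assumes "t \<in> carrier T" obtains c where "Poly_Mapping.keys c \<subseteq> pairs" "t = cls c"
  using assms by (auto simp: carrier_T)

lemma add_T:
  "Poly_Mapping.keys c \<subseteq> pairs \<Longrightarrow> Poly_Mapping.keys d \<subseteq> pairs \<Longrightarrow> cls c \<oplus>\<^bsub>T\<^esub> cls d = cls (c + d)"
  using rel.rcos_sum[of c d] by (simp add: tensor_module_def FactGroup_def carrier_F mult_F Let_def)

lemma zero_T: "\<zero>\<^bsub>T\<^esub> = cls 0"
proof -
  have "rel #>\<^bsub>F\<^esub> \<one>\<^bsub>F\<^esub> = rel" by (intro F.coset_mult_one rel.subset)
  then show ?thesis by (simp add: tensor_module_def FactGroup_def one_F Let_def)
qed

lemma cls_closed: "Poly_Mapping.keys c \<subseteq> pairs \<Longrightarrow> cls c \<in> carrier T"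
  by (auto simp: carrier_T)

lemma abelian_group_T: "abelian_group T"
proof (rule abelian_groupI; (elim carrierE; simp)?)
  fix c d :: "'a \<times> 'b \<Rightarrow>\<^sub>0 int" assume c: "Poly_Mapping.keys c \<subseteq> pairs" "Poly_Mapping.keys d \<subseteq> pairs"
  then have cd: "Poly_Mapping.keys (c + d) \<subseteq> pairs"
    using Poly_Mapping.keys_add[of c d] by blast
  show "cls c \<oplus>\<^bsub>T\<^esub> cls d \<in> carrier T"
    using c cd by (simp add: add_T cls_closed)
  show "cls c \<oplus>\<^bsub>T\<^esub> cls d = cls d \<oplus>\<^bsub>T\<^esub> cls c"
    using c by (simp add: add_T add.commute)
  fix e :: "'a \<times> 'b \<Rightarrow>\<^sub>0 int" assume e: "Poly_Mapping.keys e \<subseteq> pairs"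
  then have "Poly_Mapping.keys (d + e) \<subseteq> pairs"
    using c Poly_Mapping.keys_add[of d e] by blast
  then show "cls c \<oplus>\<^bsub>T\<^esub> cls d \<oplus>\<^bsub>T\<^esub> cls e = cls c \<oplus>\<^bsub>T\<^esub> (cls d \<oplus>\<^bsub>T\<^esub> cls e)"
    using c cd e by (simp add: add_T add.assoc)
next
  show "\<zero>\<^bsub>T\<^esub> \<in> carrier T" by (simp add: zero_T cls_closed)
next
  fix c :: "'a \<times> 'b \<Rightarrow>\<^sub>0 int" assume c: "Poly_Mapping.keys c \<subseteq> pairs"
  then show "\<zero>\<^bsub>T\<^esub> \<oplus>\<^bsub>T\<^esub> cls c = cls c" by (simp add: zero_T add_T)
  show "\<exists>y\<in>carrier T. y \<oplus>\<^bsub>T\<^esub> cls c = \<zero>\<^bsub>T\<^esub>"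
    using c by (intro bexI[of _ "cls (- c)"]) (simp_all add: zero_T add_T cls_closed)
qed

text \<open>The operation on formal sums inside the scalar multiplication of
  \<open>tensor_module\<close>. The union over a coset that is taken there collapses to a single
  coset once \<open>scale\<close> preserves the relations.\<close>

definition scale :: "'k \<Rightarrow> ('a \<times> 'b \<Rightarrow>\<^sub>0 int) \<Rightarrow> ('a \<times> 'b \<Rightarrow>\<^sub>0 int)" where
  "scale r = frag_extend (\<lambda>(a, b). frag_of (r \<odot>\<^bsub>M\<^esub> a, b))"

lemma scale_simps [simp]:
  "scale r 0 = 0" "scale r (frag_of (a, b)) = frag_of (r \<odot>\<^bsub>M\<^esub> a, b)"
  "scale r (c + d) = scale r c + scale r d" "scale r (c - d) = scale r c - scale r d"
  "scale r (- c) = - scale r c"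
  by (simp_all add: scale_def frag_extend_add frag_extend_diff frag_extend_minus)

lemma scale_closed:
  assumes "r \<in> carrier R" "Poly_Mapping.keys c \<subseteq> pairs"
  shows "Poly_Mapping.keys (scale r c) \<subseteq> pairs"
  using assms(2)
proof (induction c rule: frag_induction)
  case (diff c d)
  then show ?case by (simp add: keys_diff_subset)
qed (use assms(1) in auto)

lemma scale_gens:
  assumes r: "r \<in> carrier R" and c: "c \<in> gens"
  shows "scale r c \<in> gens"
  using c
proof (cases rule: gensE)
  case (left a a' b)
  then show ?thesis
    using r gensI(1)[of "r \<odot>\<^bsub>M\<^esub> a" "r \<odot>\<^bsub>M\<^esub> a'" b] by (simp add: M.smult_r_distr)
next
  case (right a b b')
  then show ?thesis
    using r gensI(2)[of "r \<odot>\<^bsub>M\<^esub> a" b b'] by simp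
next
  case (balanced s a b)
  \<comment> \<open>Scaling acts on the left factor only; commutativity of the base ring lets
    \<open>r\<close> pass the scalar of the balancing relation.\<close>
  then have "r \<odot>\<^bsub>M\<^esub> (s \<odot>\<^bsub>M\<^esub> a) = s \<odot>\<^bsub>M\<^esub> (r \<odot>\<^bsub>M\<^esub> a)"
    using r by (metis M.m_comm M.smult_assoc1)
  then show ?thesis
    using balanced r gensI(3)[of s "r \<odot>\<^bsub>M\<^esub> a" b] by simp
qed

lemma scale_rel:
  assumes r: "r \<in> carrier R" and c: "c \<in> rel"
  shows "scale r c \<in> rel"
  using c by (induction rule: rel_induct)
    (auto simp: rel_zero intro: rel_add rel_minus rel_gens scale_gens[OF r])

lemma smult_T:
  assumes r: "r \<in> carrier R" and c: "Poly_Mapping.keys c \<subseteq> pairs"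
  shows "r \<odot>\<^bsub>T\<^esub> cls c = cls (scale r c)"
proof -
  have "cls (scale r d) = cls (scale r c)" if "d \<in> cls c" for d
  proof -
    have d: "d - c \<in> rel" using that c by (simp add: mem_cls_iff)
    then have "d - c + c \<in> carrier F"
      using rel_subset[OF d] c keys_add[of "d - c" c] unfolding carrier_F by blast
    then have keys: "Poly_Mapping.keys d \<subseteq> pairs" by (simp add: carrier_F)
    have "scale r d - scale r c \<in> rel"
      using scale_rel[OF r d] by simp
    then show ?thesis
      using keys c r by (simp add: cls_eq_iff scale_closed)
  qed
  \<comment> \<open>All members of the union below are equal; since the coset is inhabited, the
    union is that common value and not the empty set.\<close>
  moreover have "c \<in> cls c" using c by (simp add: mem_cls_iff rel_zero)
  ultimately have "(\<Union>d\<in>cls c. cls (scale r d)) = cls (scale r c)" by blast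
  then show ?thesis by (simp add: tensor_module_def scale_def Let_def)
qed

lemma cls_pure: "cls (frag_of (a, b)) = pure_tensor R M N a b"
  by (simp add: pure_tensor_def)

lemma module_T: "module R T"
proof (rule moduleI[OF M.is_cring abelian_group_T]; (elim carrierE; simp)?)
  fix r and c :: "'a \<times> 'b \<Rightarrow>\<^sub>0 int" assume r: "r \<in> carrier R" and c: "Poly_Mapping.keys c \<subseteq> pairs"
  note * = scale_closed[OF r c]
  then show "r \<odot>\<^bsub>T\<^esub> cls c \<in> carrier T"
    using r c by (simp add: smult_T cls_closed)
  fix d :: "'a \<times> 'b \<Rightarrow>\<^sub>0 int" assume d: "Poly_Mapping.keys d \<subseteq> pairs"
  have "Poly_Mapping.keys (c + d) \<subseteq> pairs" using c d keys_add[of c d] by blast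
  then show "r \<odot>\<^bsub>T\<^esub> (cls c \<oplus>\<^bsub>T\<^esub> cls d) = r \<odot>\<^bsub>T\<^esub> cls c \<oplus>\<^bsub>T\<^esub> r \<odot>\<^bsub>T\<^esub> cls d"
    using * r c d by (simp add: smult_T add_T scale_closed)
next
  fix r s and c :: "'a \<times> 'b \<Rightarrow>\<^sub>0 int" assume rs: "r \<in> carrier R" "s \<in> carrier R" and c: "Poly_Mapping.keys c \<subseteq> pairs"
  have sc: "Poly_Mapping.keys (scale r c) \<subseteq> pairs" "Poly_Mapping.keys (scale s c) \<subseteq> pairs"
    "Poly_Mapping.keys (scale (r \<oplus> s) c) \<subseteq> pairs"
    using rs c by (simp_all add: scale_closed)
  then have sum: "Poly_Mapping.keys (scale r c + scale s c) \<subseteq> pairs"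
    using keys_add[of "scale r c" "scale s c"] by blast
  \<comment> \<open>The one module law that holds only modulo the relations; the others already hold
    for formal sums.\<close>
  have "scale (r \<oplus> s) c - (scale r c + scale s c) \<in> rel"
    using c
  proof (induction c rule: frag_induction)
    case (one x)
    then obtain a b where x: "x = (a, b)" "a \<in> carrier M" "b \<in> carrier N" by auto
    then show ?case
      using rel_gens[OF gensI(1)[of "r \<odot>\<^bsub>M\<^esub> a" "s \<odot>\<^bsub>M\<^esub> a" b]] rs
      by (simp add: M.smult_l_distr diff_diff_eq)
  next
    case (diff c d)
    from rel_diff[OF this] show ?case by (simp add: algebra_simps)
  qed (simp add: rel_zero)
  then have "cls (scale (r \<oplus> s) c) = cls (scale r c + scale s c)"
    using sc sum by (simp add: cls_eq_iff)
  then show "(r \<oplus> s) \<odot>\<^bsub>T\<^esub> cls c = r \<odot>\<^bsub>T\<^esub> cls c \<oplus>\<^bsub>T\<^esub> s \<odot>\<^bsub>T\<^esub> cls c"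
    using rs c sc by (simp add: smult_T add_T)
  have "scale (r \<otimes> s) c = scale r (scale s c)"
    using c by (induction c rule: frag_induction) (use rs in \<open>auto simp: M.smult_assoc1\<close>)
  then show "(r \<otimes> s) \<odot>\<^bsub>T\<^esub> cls c = r \<odot>\<^bsub>T\<^esub> (s \<odot>\<^bsub>T\<^esub> cls c)"
    using rs c sc by (simp add: smult_T)
next
  fix c :: "'a \<times> 'b \<Rightarrow>\<^sub>0 int" assume c: "Poly_Mapping.keys c \<subseteq> pairs"
  then have "scale \<one> c = c"
    by (induction c rule: frag_induction) auto
  then show "\<one> \<odot>\<^bsub>T\<^esub> cls c = cls c"
    using c by (simp add: smult_T)
qed

section \<open>Pure tensors\<close>

lemma pure_closed: "a \<in> carrier M \<Longrightarrow> b \<in> carrier N \<Longrightarrow> pure_tensor R M N a b \<in> carrier T"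
  by (simp add: cls_pure[symmetric] cls_closed)

text \<open>The additivity relation for zero plus zero is the negative of this generator.\<close>

lemma rel_frag_zero:
  assumes "b \<in> carrier N"
  shows "frag_of (\<zero>\<^bsub>M\<^esub>, b) \<in> rel"
proof -
  have "- (frag_of (\<zero>\<^bsub>M\<^esub> \<oplus>\<^bsub>M\<^esub> \<zero>\<^bsub>M\<^esub>, b) - frag_of (\<zero>\<^bsub>M\<^esub>, b) - frag_of (\<zero>\<^bsub>M\<^esub>, b)) \<in> rel"
    using assms by (intro rel_minus rel_gens gensI) auto
  then show ?thesis by simp
qed

text \<open>Common source of the two additivity laws of pure tensors, which differ only in the
  relation supplied.\<close>

lemma cls_pure_add:
  assumes ab: "a \<in> carrier M" "b \<in> carrier N" "a' \<in> carrier M" "b' \<in> carrier N"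
    and c: "c \<in> pairs" and rel: "frag_of c - frag_of (a, b) - frag_of (a', b') \<in> rel"
  shows "cls (frag_of c) = pure_tensor R M N a b \<oplus>\<^bsub>T\<^esub> pure_tensor R M N a' b'"
proof -
  have keys: "Poly_Mapping.keys (frag_of (a, b) + frag_of (a', b')) \<subseteq> pairs"
    using keys_add[of "frag_of (a, b)" "frag_of (a', b')"] ab by auto
  have "cls (frag_of c) = cls (frag_of (a, b) + frag_of (a', b'))"
    using keys c rel by (subst cls_eq_iff) (auto simp: diff_diff_eq)
  also have "\<dots> = pure_tensor R M N a b \<oplus>\<^bsub>T\<^esub> pure_tensor R M N a' b'"
    using ab by (simp add: cls_pure[symmetric] add_T)
  finally show ?thesis .
qed

lemma pure_add_left:
  "\<lbrakk>a \<in> carrier M; a' \<in> carrier M; b \<in> carrier N\<rbrakk> \<Longrightarrow>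
    pure_tensor R M N (a \<oplus>\<^bsub>M\<^esub> a') b = pure_tensor R M N a b \<oplus>\<^bsub>T\<^esub> pure_tensor R M N a' b"
  using cls_pure_add[OF _ _ _ _ _ rel_gens[OF gensI(1)]] by (simp add: cls_pure)

lemma pure_add_right:
  "\<lbrakk>a \<in> carrier M; b \<in> carrier N; b' \<in> carrier N\<rbrakk> \<Longrightarrow>
    pure_tensor R M N a (b \<oplus>\<^bsub>N\<^esub> b') = pure_tensor R M N a b \<oplus>\<^bsub>T\<^esub> pure_tensor R M N a b'"
  using cls_pure_add[OF _ _ _ _ _ rel_gens[OF gensI(2)]] by (simp add: cls_pure)

lemma pure_smult_left:
  "\<lbrakk>r \<in> carrier R; a \<in> carrier M; b \<in> carrier N\<rbrakk> \<Longrightarrow>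
    pure_tensor R M N (r \<odot>\<^bsub>M\<^esub> a) b = r \<odot>\<^bsub>T\<^esub> pure_tensor R M N a b"
  by (simp add: cls_pure[symmetric] smult_T)

lemma pure_smult_right:
  assumes "r \<in> carrier R" "a \<in> carrier M" "b \<in> carrier N"
  shows "pure_tensor R M N a (r \<odot>\<^bsub>N\<^esub> b) = r \<odot>\<^bsub>T\<^esub> pure_tensor R M N a b"
proof -
  have "cls (frag_of (r \<odot>\<^bsub>M\<^esub> a, b)) = cls (frag_of (a, r \<odot>\<^bsub>N\<^esub> b))"
    using assms by (subst cls_eq_iff) (auto intro!: rel_gens gensI)
  then show ?thesis
    using assms pure_smult_left[of r a b] by (simp add: cls_pure)
qed

lemma pure_linear_left: "b \<in> carrier N \<Longrightarrow> (\<lambda>a. pure_tensor R M N a b) \<in> linear_maps R M T"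
  by (simp add: linear_maps_def pure_closed pure_add_left pure_smult_left)

lemma pure_linear_right: "a \<in> carrier M \<Longrightarrow> (\<lambda>b. pure_tensor R M N a b) \<in> linear_maps R N T"
  by (simp add: linear_maps_def pure_closed pure_add_right pure_smult_right)

sublocale T: module R T
  by (rule module_T)

text \<open>Sums of pure tensors suffice, without cases for zero and negatives: zero is a pure
  tensor of zeros, and the negative of a \<otimes> b is the pure tensor of the negative of a with
  b.\<close>

lemma tensor_induct [consumes 1, case_names pure add]:
  assumes t: "t \<in> carrier T"
    and pure: "\<And>a b. a \<in> carrier M \<Longrightarrow> b \<in> carrier N \<Longrightarrow> P (pure_tensor R M N a b)"
    and add: "\<And>s t. \<lbrakk>s \<in> carrier T; t \<in> carrier T; P s; P t\<rbrakk> \<Longrightarrow> P (s \<oplus>\<^bsub>T\<^esub> t)"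
  shows "P t"
proof -
  obtain c where c: "Poly_Mapping.keys c \<subseteq> pairs" and tc: "t = cls c"
    using t by (rule carrierE)
  \<comment> \<open>\<open>frag_induction\<close> subtracts whereas \<open>P\<close> is only closed
    under addition, so the claim is carried for \<open>c\<close> and for its negative.\<close>
  have "Poly_Mapping.keys c \<subseteq> pairs \<and> P (cls c) \<and> P (cls (- c))"
    using c
  proof (induction c rule: frag_induction)
    case zero
    have "P (pure_tensor R M N \<zero>\<^bsub>M\<^esub> \<zero>\<^bsub>N\<^esub>)" by (intro pure) auto
    moreover have "pure_tensor R M N \<zero>\<^bsub>M\<^esub> \<zero>\<^bsub>N\<^esub> = cls 0"
      unfolding cls_pure[symmetric] using rel_frag_zero by (subst cls_eq_iff) auto
    ultimately show ?case by simp
  next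
    case (one x)
    then obtain a b where x: "x = (a, b)" "a \<in> carrier M" "b \<in> carrier N" by auto
    have "P (pure_tensor R M N (\<ominus>\<^bsub>M\<^esub> a) b)" using x by (intro pure) auto
    moreover have "pure_tensor R M N (\<ominus>\<^bsub>M\<^esub> a) b = cls (- frag_of (a, b))"
    proof (unfold cls_pure[symmetric], subst cls_eq_iff)
      \<comment> \<open>The generator for zero and \<open>b\<close>, minus this relation, is the sum
        of the generators for \<open>a\<close> and for its negative.\<close>
      have "frag_of (a \<oplus>\<^bsub>M\<^esub> \<ominus>\<^bsub>M\<^esub> a, b) - frag_of (a, b) - frag_of (\<ominus>\<^bsub>M\<^esub> a, b) \<in> rel"
        using x by (intro rel_gens gensI) auto
      from rel_diff[OF rel_frag_zero[OF x(3)] this]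
      show "frag_of (\<ominus>\<^bsub>M\<^esub> a, b) - - frag_of (a, b) \<in> rel"
        using x by (simp add: M.r_neg)
    qed (use x in auto)
    ultimately show ?case using x pure[of a b] by (simp add: cls_pure)
  next
    case (diff c d)
    then have keys: "Poly_Mapping.keys (- c) \<subseteq> pairs" "Poly_Mapping.keys (- d) \<subseteq> pairs"
      "Poly_Mapping.keys (c - d) \<subseteq> pairs"
      using keys_diff_subset by auto
    have "P (cls c \<oplus>\<^bsub>T\<^esub> cls (- d))" "P (cls (- c) \<oplus>\<^bsub>T\<^esub> cls d)"
      using diff keys by (auto intro!: add cls_closed)
    then show ?case
      using diff keys by (simp add: add_T)
  qed
  then show ?thesis by (simp add: tc)
qed

end

section \<open>Linear and bilinear maps\<close>

lemma linear_mapsI: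
  assumes "\<And>x. x \<in> carrier M \<Longrightarrow> f x \<in> carrier N"
    and "\<And>x y. x \<in> carrier M \<Longrightarrow> y \<in> carrier M \<Longrightarrow> f (x \<oplus>\<^bsub>M\<^esub> y) = f x \<oplus>\<^bsub>N\<^esub> f y"
    and "\<And>r x. r \<in> carrier R \<Longrightarrow> x \<in> carrier M \<Longrightarrow> f (r \<odot>\<^bsub>M\<^esub> x) = r \<odot>\<^bsub>N\<^esub> f x"
  shows "f \<in> linear_maps R M N"
  using assms by (auto simp: linear_maps_def)

lemma linear_mapsD:
  assumes "f \<in> linear_maps R M N"
  shows "x \<in> carrier M \<Longrightarrow> f x \<in> carrier N"
    and "x \<in> carrier M \<Longrightarrow> y \<in> carrier M \<Longrightarrow> f (x \<oplus>\<^bsub>M\<^esub> y) = f x \<oplus>\<^bsub>N\<^esub> f y"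
    and "r \<in> carrier R \<Longrightarrow> x \<in> carrier M \<Longrightarrow> f (r \<odot>\<^bsub>M\<^esub> x) = r \<odot>\<^bsub>N\<^esub> f x"
  using assms by (auto simp: linear_maps_def)

lemma linear_maps_ident: "(\<lambda>x. x) \<in> linear_maps R M M"
  by (simp add: linear_maps_def)

lemma linear_maps_compose:
  "f \<in> linear_maps R N P \<Longrightarrow> g \<in> linear_maps R M N \<Longrightarrow> (\<lambda>x. f (g x)) \<in> linear_maps R M P"
  by (auto simp: linear_maps_def Pi_iff)

lemma linear_maps_smult:
  assumes "module R M" "r \<in> carrier R"
  shows "(\<lambda>x. r \<odot>\<^bsub>M\<^esub> x) \<in> linear_maps R M M"
proof -
  interpret module R M by fact
  show ?thesis
  proof (rule linear_mapsI)
    show "r \<odot>\<^bsub>M\<^esub> (s \<odot>\<^bsub>M\<^esub> x) = s \<odot>\<^bsub>M\<^esub> (r \<odot>\<^bsub>M\<^esub> x)" if "s \<in> carrier R" "x \<in> carrier M" for s x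
      using that assms by (metis m_comm smult_assoc1)
  qed (use assms in \<open>auto simp: smult_r_distr\<close>)
qed

text \<open>Negation is scaling by minus one, so additivity and homogeneity are enough.\<close>

lemma linear_maps_minus:
  assumes "module R M" "module R N" and f: "f \<in> linear_maps R M N"
    and x: "x \<in> carrier M" and y: "y \<in> carrier M"
  shows "f (x \<ominus>\<^bsub>M\<^esub> y) = f x \<ominus>\<^bsub>N\<^esub> f y"
proof -
  interpret M: module R M by fact
  interpret N: module R N by fact
  have "f ((\<ominus>\<^bsub>R\<^esub> \<one>\<^bsub>R\<^esub>) \<odot>\<^bsub>M\<^esub> y) = (\<ominus>\<^bsub>R\<^esub> \<one>\<^bsub>R\<^esub>) \<odot>\<^bsub>N\<^esub> f y"
    using linear_mapsD(3)[OF f] y by simp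
  then have "f (\<ominus>\<^bsub>M\<^esub> y) = \<ominus>\<^bsub>N\<^esub> f y"
    using y linear_mapsD(1)[OF f y] by (simp add: M.smult_l_minus N.smult_l_minus)
  then show ?thesis
    using linear_mapsD(2)[OF f x, of "\<ominus>\<^bsub>M\<^esub> y"] y by (simp add: a_minus_def)
qed

lemma linear_maps_zero:
  assumes "module R M" "module R N" and f: "f \<in> linear_maps R M N"
  shows "f \<zero>\<^bsub>M\<^esub> = \<zero>\<^bsub>N\<^esub>"
proof -
  interpret M: module R M by fact
  interpret N: module R N by fact
  show ?thesis
    using linear_maps_minus[OF assms M.zero_closed M.zero_closed] linear_mapsD(1)[OF f M.zero_closed]
    by (simp add: a_minus_def M.r_neg N.r_neg)
qed

text \<open>Homogeneity in both variables already contains the balancing law: the scalar comes out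
  of either argument with the same result.\<close>

definition bilinear_maps ::
  "('k, 'r) ring_scheme \<Rightarrow> ('k, 'a, 'm) module_scheme \<Rightarrow> ('k, 'b, 'n) module_scheme \<Rightarrow>
    ('k, 'c, 'o) module_scheme \<Rightarrow> ('a \<Rightarrow> 'b \<Rightarrow> 'c) set"
  where "bilinear_maps R M N P =
    {f. (\<forall>b\<in>carrier N. (\<lambda>a. f a b) \<in> linear_maps R M P) \<and>
        (\<forall>a\<in>carrier M. (\<lambda>b. f a b) \<in> linear_maps R N P)}"

lemma bilinear_mapsI:
  assumes "\<And>b. b \<in> carrier N \<Longrightarrow> (\<lambda>a. f a b) \<in> linear_maps R M P"
    and "\<And>a. a \<in> carrier M \<Longrightarrow> (\<lambda>b. f a b) \<in> linear_maps R N P"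
  shows "f \<in> bilinear_maps R M N P"
  using assms by (simp add: bilinear_maps_def)

lemma bilinear_mapsD:
  assumes "f \<in> bilinear_maps R M N P"
  shows "b \<in> carrier N \<Longrightarrow> (\<lambda>a. f a b) \<in> linear_maps R M P"
    and "a \<in> carrier M \<Longrightarrow> (\<lambda>b. f a b) \<in> linear_maps R N P"
    and "a \<in> carrier M \<Longrightarrow> b \<in> carrier N \<Longrightarrow> f a b \<in> carrier P"
  using assms by (auto simp: bilinear_maps_def dest: linear_mapsD(1))

section \<open>Linearity of formal sums\<close>

lemma frag_finsum_cong:
  assumes "abelian_group P" "Poly_Mapping.keys c \<subseteq> B"
    and "\<And>z. z \<in> B \<Longrightarrow> f z = g z" "\<And>z. z \<in> B \<Longrightarrow> g z \<in> carrier P"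
  shows "frag_finsum P f c = frag_finsum P g c"
proof -
  interpret P: abelian_group P by fact
  show ?thesis
    unfolding frag_finsum_def using assms
    by (intro P.finsum_cong') (auto intro!: P.add.int_pow_closed)
qed

lemma frag_finsum_linear:
  assumes P: "module R P" and Q: "module R Q" and h: "h \<in> linear_maps R P Q"
    and c: "Poly_Mapping.keys c \<subseteq> B" and f: "f \<in> B \<rightarrow> carrier P"
  shows "h (frag_finsum P f c) = frag_finsum Q (\<lambda>z. h (f z)) c"
proof -
  interpret P: module R P by fact
  interpret Q: module R Q by fact
  have hf: "(\<lambda>z. h (f z)) \<in> B \<rightarrow> carrier Q"
    using f linear_mapsD(1)[OF h] by auto
  have "Poly_Mapping.keys c \<subseteq> B \<and> h (frag_finsum P f c) = frag_finsum Q (\<lambda>z. h (f z)) c"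
    using c
  proof (induction c rule: frag_induction)
    case zero
    then show ?case by (simp add: linear_maps_zero[OF P Q h])
  next
    case (one x)
    then show ?case using f hf by (auto simp: Pi_iff)
  next
    case (diff c d)
    moreover have "Poly_Mapping.keys (c - d) \<subseteq> B"
      using diff keys_diff[of c d] by blast
    ultimately show ?case
      using f hf by (simp add: P.frag_finsum_diff[of _ B] Q.frag_finsum_diff[of _ B]
          linear_maps_minus[OF P Q h] P.frag_finsum_closed[of _ B])
  qed
  then show ?thesis by simp
qed

lemma (in abelian_group) frag_finsum_addf:
  assumes "Poly_Mapping.keys c \<subseteq> B" "f \<in> B \<rightarrow> carrier G" "g \<in> B \<rightarrow> carrier G"
  shows "frag_finsum G (\<lambda>z. f z \<oplus> g z) c = frag_finsum G f c \<oplus> frag_finsum G g c"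
proof -
  have "frag_finsum G (\<lambda>z. f z \<oplus> g z) c = (\<Oplus>z\<in>Poly_Mapping.keys c.
      [Poly_Mapping.lookup c z] \<cdot> f z \<oplus> [Poly_Mapping.lookup c z] \<cdot> g z)"
    unfolding frag_finsum_def using assms
    by (intro finsum_cong') (auto simp: Pi_iff subset_iff add.int_pow_distrib add.int_pow_closed)
  also have "\<dots> = frag_finsum G f c \<oplus> frag_finsum G g c"
    unfolding frag_finsum_def using assms
    by (intro finsum_addf) (auto simp: Pi_iff subset_iff add.int_pow_closed)
  finally show ?thesis .
qed

lemma (in abelian_group) frag_finsum_subf:
  assumes c: "Poly_Mapping.keys c \<subseteq> B" and f: "f \<in> B \<rightarrow> carrier G" and g: "g \<in> B \<rightarrow> carrier G"
  shows "frag_finsum G (\<lambda>z. f z \<ominus> g z) c = frag_finsum G f c \<ominus> frag_finsum G g c"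
proof -
  have fg: "(\<lambda>z. f z \<ominus> g z) \<in> B \<rightarrow> carrier G" using f g by auto
  have "frag_finsum G f c = frag_finsum G (\<lambda>z. (f z \<ominus> g z) \<oplus> g z) c"
    using c f g by (intro frag_finsum_cong[where B = B])
      (auto simp: Pi_iff a_minus_def a_assoc l_neg abelian_group_axioms)
  also have "\<dots> = frag_finsum G (\<lambda>z. f z \<ominus> g z) c \<oplus> frag_finsum G g c"
    by (intro frag_finsum_addf[where B = B] c fg g)
  finally show ?thesis
    using frag_finsum_closed[OF c g] frag_finsum_closed[OF c fg]
    by (simp add: a_minus_def a_assoc r_neg)
qed

text \<open>Fubini for two formal sums, by induction on \<open>c\<close> with \<open>d\<close>
  fixed: on the left the outer sum is additive in \<open>c\<close>; on the right the inner sums are,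
  and the sum over \<open>d\<close> is additive in its summands.\<close>

lemma (in abelian_group) frag_finsum_swap:
  assumes c: "Poly_Mapping.keys c \<subseteq> B" and d: "Poly_Mapping.keys d \<subseteq> D"
    and f: "\<And>x y. x \<in> B \<Longrightarrow> y \<in> D \<Longrightarrow> f x y \<in> carrier G"
  shows "frag_finsum G (\<lambda>x. frag_finsum G (\<lambda>y. f x y) d) c =
    frag_finsum G (\<lambda>y. frag_finsum G (\<lambda>x. f x y) c) d"
proof -
  have cl: "(\<lambda>x. frag_finsum G (\<lambda>y. f x y) d) \<in> B \<rightarrow> carrier G"
    using f by (auto intro!: frag_finsum_closed[OF d])
  have "Poly_Mapping.keys c \<subseteq> B \<and>
    frag_finsum G (\<lambda>x. frag_finsum G (\<lambda>y. f x y) d) c =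
    frag_finsum G (\<lambda>y. frag_finsum G (\<lambda>x. f x y) c) d"
    using c
  proof (induction c rule: frag_induction)
    case zero
    \<comment> \<open>A sum of zeros equals its difference with itself.\<close>
    have "frag_finsum G (\<lambda>y. \<zero>) d = \<zero> \<ominus> \<zero>"
      using frag_finsum_subf[OF d, of "\<lambda>y. \<zero>" "\<lambda>y. \<zero>"]
        frag_finsum_closed[OF d, of "\<lambda>y. \<zero>"] by (simp add: a_minus_def r_neg)
    then show ?case by (simp add: a_minus_def r_neg)
  next
    case (one x)
    have "frag_finsum G (\<lambda>y. frag_finsum G (\<lambda>x. f x y) (frag_of x)) d = frag_finsum G (f x) d"
      using one f by (intro frag_finsum_cong[OF abelian_group_axioms d]) auto
    then show ?case using one cl by (auto simp: Pi_iff)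
  next
    case (diff a b)
    then have ab: "Poly_Mapping.keys a \<subseteq> B" "Poly_Mapping.keys b \<subseteq> B" "Poly_Mapping.keys (a - b) \<subseteq> B"
      using keys_diff[of a b] by blast+
    have "frag_finsum G (\<lambda>y. frag_finsum G (\<lambda>x. f x y) (a - b)) d =
        frag_finsum G (\<lambda>y. frag_finsum G (\<lambda>x. f x y) a \<ominus> frag_finsum G (\<lambda>x. f x y) b) d"
      using ab f by (intro frag_finsum_cong[OF abelian_group_axioms d])
        (auto simp: frag_finsum_diff[of _ B] Pi_iff intro!: frag_finsum_closed[of _ B] minus_closed)
    also have "\<dots> = frag_finsum G (\<lambda>y. frag_finsum G (\<lambda>x. f x y) a) d \<ominus>
        frag_finsum G (\<lambda>y. frag_finsum G (\<lambda>x. f x y) b) d"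
      using ab f by (intro frag_finsum_subf[OF d]) (auto intro!: frag_finsum_closed[of _ B])
    finally show ?case
      using diff ab cl by (simp add: frag_finsum_diff[of _ B])
  qed
  then show ?thesis by simp
qed

section \<open>The universal property\<close>

context two_modules
begin

text \<open>The choice that \<open>tensor_lift\<close> makes, named so that one tensor visibly has
  one representative throughout an argument.\<close>

definition rep :: "('a, 'b) tensor \<Rightarrow> ('a \<times> 'b \<Rightarrow>\<^sub>0 int)" where
  "rep t = (SOME c. c \<in> t)"

lemma tensor_lift_rep: "tensor_lift P f t = frag_finsum P (\<lambda>z. f (fst z) (snd z)) (rep t)"
  by (simp add: tensor_lift_eq_frag_finsum rep_def)

lemma rep:
  assumes "t \<in> carrier T"
  shows "Poly_Mapping.keys (rep t) \<subseteq> pairs" "cls (rep t) = t"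
proof -
  obtain c where c: "Poly_Mapping.keys c \<subseteq> pairs" and t: "t = cls c"
    using assms by (rule carrierE)
  have "c \<in> t" using c by (simp add: t mem_cls_iff rel_zero)
  then have "rep t \<in> cls c" unfolding rep_def t by (rule someI)
  then have d: "rep t - c \<in> rel" using c by (simp add: mem_cls_iff)
  then show k: "Poly_Mapping.keys (rep t) \<subseteq> pairs"
    using rel_subset[OF d] c keys_add[of "rep t - c" c] by (simp, blast)
  show "cls (rep t) = t"
    using d k c by (simp add: t cls_eq_iff)
qed

section \<open>Sums over a fixed tensor, and the lift of a bilinear map\<close>

lemma lift_closed:
  assumes "module R P" "t \<in> carrier T"
    and "\<And>a b. a \<in> carrier M \<Longrightarrow> b \<in> carrier N \<Longrightarrow> f a b \<in> carrier P"
  shows "tensor_lift P f t \<in> carrier P"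
proof -
  interpret P: module R P by fact
  show ?thesis
    unfolding tensor_lift_rep using assms
    by (intro P.frag_finsum_closed[OF rep(1)]) auto
qed

lemma lift_cong:
  assumes "module R P" "t \<in> carrier T"
    and "\<And>a b. a \<in> carrier M \<Longrightarrow> b \<in> carrier N \<Longrightarrow> f a b = g a b"
    and "\<And>a b. a \<in> carrier M \<Longrightarrow> b \<in> carrier N \<Longrightarrow> g a b \<in> carrier P"
  shows "tensor_lift P f t = tensor_lift P g t"
proof -
  interpret P: module R P by fact
  show ?thesis
    unfolding tensor_lift_rep using assms
    by (intro frag_finsum_cong[OF P.abelian_group_axioms rep(1)]) auto
qed

lemma linear_lift:
  assumes "module R P" "module R Q" "h \<in> linear_maps R P Q" "t \<in> carrier T"
    and "\<And>a b. a \<in> carrier M \<Longrightarrow> b \<in> carrier N \<Longrightarrow> f a b \<in> carrier P"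
  shows "h (tensor_lift P f t) = tensor_lift Q (\<lambda>a b. h (f a b)) t"
  unfolding tensor_lift_rep using assms
  by (intro frag_finsum_linear[OF _ _ _ rep(1)]) auto

text \<open>The tensor stays fixed and with it the representative, so linearity in the parameter
  passes to the sum termwise. Linearity in the tensor itself is \<open>lift_linear\<close>.\<close>

lemma lift_linear_param:
  assumes P: "module R P" and t: "t \<in> carrier T"
    and f: "\<And>a b. a \<in> carrier M \<Longrightarrow> b \<in> carrier N \<Longrightarrow> (\<lambda>x. f x a b) \<in> linear_maps R Q P"
  shows "(\<lambda>x. tensor_lift P (f x) t) \<in> linear_maps R Q P"
proof (rule linear_mapsI)
  interpret P: module R P by fact
  note D = linear_mapsD[OF f]
  show cl: "tensor_lift P (f x) t \<in> carrier P" if "x \<in> carrier Q" for x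
    using that D by (intro lift_closed[OF P t]) auto
  show "tensor_lift P (f (x \<oplus>\<^bsub>Q\<^esub> y)) t = tensor_lift P (f x) t \<oplus>\<^bsub>P\<^esub> tensor_lift P (f y) t"
    if "x \<in> carrier Q" "y \<in> carrier Q" for x y
  proof -
    have "tensor_lift P (f (x \<oplus>\<^bsub>Q\<^esub> y)) t = tensor_lift P (\<lambda>a b. f x a b \<oplus>\<^bsub>P\<^esub> f y a b) t"
      using that D by (intro lift_cong[OF P t]) auto
    also have "\<dots> = tensor_lift P (f x) t \<oplus>\<^bsub>P\<^esub> tensor_lift P (f y) t"
      unfolding tensor_lift_rep using that D by (intro P.frag_finsum_addf[OF rep(1)[OF t]]) auto
    finally show ?thesis .
  qed
  show "tensor_lift P (f (r \<odot>\<^bsub>Q\<^esub> x)) t = r \<odot>\<^bsub>P\<^esub> tensor_lift P (f x) t"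
    if "r \<in> carrier R" "x \<in> carrier Q" for r x
  proof -
    have "tensor_lift P (f (r \<odot>\<^bsub>Q\<^esub> x)) t = tensor_lift P (\<lambda>a b. r \<odot>\<^bsub>P\<^esub> f x a b) t"
      using that D by (intro lift_cong[OF P t]) auto
    also have "\<dots> = r \<odot>\<^bsub>P\<^esub> tensor_lift P (f x) t"
      using that D by (intro linear_lift[symmetric, OF P P linear_maps_smult[OF P] t]) auto
    finally show ?thesis .
  qed
qed

text \<open>Additivity in either variable kills one kind of relation, and homogeneity in both kills
  the balancing relations. The formal sums that are killed are closed under addition and negation,
  which covers the generated subgroup.\<close>

lemma frag_finsum_rel:
  assumes "module R P" and f: "f \<in> bilinear_maps R M N P" and c: "c \<in> rel"
  shows "frag_finsum P (\<lambda>z. f (fst z) (snd z)) c = \<zero>\<^bsub>P\<^esub>"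
proof -
  interpret P: module R P by fact
  let ?f = "\<lambda>z. f (fst z) (snd z)"
  note cl = bilinear_mapsD(3)[OF f]
  have cl': "?f \<in> pairs \<rightarrow> carrier P" using cl by auto
  have 0: "frag_finsum P ?f (frag_of z) = ?f z" if "z \<in> pairs" for z
    using that cl by auto
  note diff = P.frag_finsum_diff[OF _ _ cl']
  have keys: "Poly_Mapping.keys (frag_of z) \<subseteq> pairs" if "z \<in> pairs" for z
    using that by simp
  note bil = linear_mapsD[OF bilinear_mapsD(1)[OF f]] linear_mapsD[OF bilinear_mapsD(2)[OF f]]
  have sub: "x \<oplus>\<^bsub>P\<^esub> y \<ominus>\<^bsub>P\<^esub> x \<ominus>\<^bsub>P\<^esub> y = \<zero>\<^bsub>P\<^esub>" if "x \<in> carrier P" "y \<in> carrier P" for x y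
  proof -
    have "x \<oplus>\<^bsub>P\<^esub> y \<ominus>\<^bsub>P\<^esub> x \<ominus>\<^bsub>P\<^esub> y = (x \<oplus>\<^bsub>P\<^esub> y) \<oplus>\<^bsub>P\<^esub> \<ominus>\<^bsub>P\<^esub> (x \<oplus>\<^bsub>P\<^esub> y)"
      using that by (simp add: a_minus_def P.minus_add P.a_assoc)
    then show ?thesis using that by (simp add: P.r_neg)
  qed
  show ?thesis using c
  proof (induction rule: rel_induct)
    case zero
    show ?case by simp
  next
    case (gen c)
    then show ?case
    proof (cases rule: gensE)
      case (left a a' b)
      then show ?thesis by (simp add: diff keys keys_diff_subset 0 bil sub cl)
    next
      case (right a b b')
      then show ?thesis by (simp add: diff keys keys_diff_subset 0 bil sub cl)
    next
      case (balanced r a b)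
      then show ?thesis by (simp add: diff keys keys_diff_subset 0 bil cl P.r_neg a_minus_def)
    qed
  next
    case (add c d)
    then show ?case by (simp add: P.frag_finsum_add[OF _ _ cl'] rel_subset)
  next
    case (minus c)
    then show ?case using diff[of 0 c] by (simp add: rel_subset a_minus_def)
  qed
qed

text \<open>The chosen representative and \<open>c\<close> differ by a relation, where the sum
  vanishes; this is independence of the choice made by \<open>SOME\<close>.\<close>

lemma lift_cls:
  assumes P: "module R P" and f: "f \<in> bilinear_maps R M N P" and c: "Poly_Mapping.keys c \<subseteq> pairs"
  shows "tensor_lift P f (cls c) = frag_finsum P (\<lambda>z. f (fst z) (snd z)) c"
proof -
  interpret P: module R P by fact
  let ?f = "\<lambda>z. f (fst z) (snd z)"
  have cl: "?f \<in> pairs \<rightarrow> carrier P" using bilinear_mapsD(3)[OF f] by auto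
  note t = cls_closed[OF c]
  have "rep (cls c) - c \<in> rel" using rep[OF t] c by (simp add: cls_eq_iff)
  then have "frag_finsum P ?f (rep (cls c) - c) = \<zero>\<^bsub>P\<^esub>"
    by (rule frag_finsum_rel[OF P f])
  then have "frag_finsum P ?f ((rep (cls c) - c) + c) = frag_finsum P ?f c"
    using P.frag_finsum_closed[OF c cl] c rep(1)[OF t]
    by (subst P.frag_finsum_add[OF _ _ cl]) (auto simp: keys_diff_subset)
  then show ?thesis by (simp add: tensor_lift_rep)
qed

lemma lift_pure:
  assumes P: "module R P" and f: "f \<in> bilinear_maps R M N P"
    and "a \<in> carrier M" "b \<in> carrier N"
  shows "tensor_lift P f (pure_tensor R M N a b) = f a b"
proof -
  interpret P: module R P by fact
  show ?thesis
    unfolding cls_pure[symmetric] using assms(3-) bilinear_mapsD(3)[OF f]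
    by (subst lift_cls[OF P f]) auto
qed

lemma lift_linear:
  assumes P: "module R P" and f: "f \<in> bilinear_maps R M N P"
  shows "tensor_lift P f \<in> linear_maps R T P"
proof (rule linear_mapsI; (elim carrierE)?; hypsubst?)
  interpret P: module R P by fact
  let ?f = "\<lambda>z. f (fst z) (snd z)"
  have cl: "?f \<in> pairs \<rightarrow> carrier P" using bilinear_mapsD(3)[OF f] by auto
  fix c :: "'a \<times> 'b \<Rightarrow>\<^sub>0 int" assume c: "Poly_Mapping.keys c \<subseteq> pairs"
  show "tensor_lift P f (cls c) \<in> carrier P"
    using c cl by (simp add: lift_cls[OF P f] P.frag_finsum_closed)
  show "tensor_lift P f (cls c \<oplus>\<^bsub>T\<^esub> cls d) = tensor_lift P f (cls c) \<oplus>\<^bsub>P\<^esub> tensor_lift P f (cls d)"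
    if d: "Poly_Mapping.keys d \<subseteq> pairs" for d
  proof -
    have "Poly_Mapping.keys (c + d) \<subseteq> pairs" using c d keys_add[of c d] by blast
    then show ?thesis
      using c d by (simp add: add_T lift_cls[OF P f] P.frag_finsum_add[OF _ _ cl])
  qed
  show "tensor_lift P f (r \<odot>\<^bsub>T\<^esub> cls c) = r \<odot>\<^bsub>P\<^esub> tensor_lift P f (cls c)" if r: "r \<in> carrier R" for r
  proof -
    have "Poly_Mapping.keys c \<subseteq> pairs \<and>
      frag_finsum P ?f (scale r c) = r \<odot>\<^bsub>P\<^esub> frag_finsum P ?f c" using c
    proof (induction c rule: frag_induction)
      case (one x)
      then show ?case
        using r bilinear_mapsD(3)[OF f] linear_mapsD(3)[OF bilinear_mapsD(1)[OF f]] by auto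
    next
      case (diff c d)
      then show ?case
        using r cl by (simp add: keys_diff_subset scale_closed P.frag_finsum_diff[of _ pairs]
            linear_maps_minus[OF P P linear_maps_smult[OF P r]] P.frag_finsum_closed[of _ pairs])
    qed (use r in simp)
    then show ?thesis
      using c r by (simp add: smult_T lift_cls[OF P f] scale_closed)
  qed
qed

lemma linear_ext:
  assumes "g \<in> linear_maps R T P" "h \<in> linear_maps R T P" "t \<in> carrier T"
    and "\<And>a b. a \<in> carrier M \<Longrightarrow> b \<in> carrier N \<Longrightarrow>
      g (pure_tensor R M N a b) = h (pure_tensor R M N a b)"
  shows "g t = h t"
  using assms(3)
  by (induction t rule: tensor_induct) (simp_all add: assms(4) linear_mapsD[OF assms(1)] linear_mapsD[OF assms(2)])

end

lemma lift_swap: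
  assumes "two_modules R M N" "two_modules R M' N'" "module R P"
    and s: "s \<in> carrier (tensor_module R M N)" and t: "t \<in> carrier (tensor_module R M' N')"
    and f: "\<And>a b c d. \<lbrakk>a \<in> carrier M; b \<in> carrier N; c \<in> carrier M'; d \<in> carrier N'\<rbrakk> \<Longrightarrow>
      f a b c d \<in> carrier P"
  shows "tensor_lift P (\<lambda>a b. tensor_lift P (\<lambda>c d. f a b c d) t) s =
    tensor_lift P (\<lambda>c d. tensor_lift P (\<lambda>a b. f a b c d) s) t"
proof -
  interpret S: two_modules R M N by fact
  interpret T: two_modules R M' N' by fact
  interpret P: module R P by fact
  show ?thesis
    unfolding S.tensor_lift_rep T.tensor_lift_rep
    using f by (intro P.frag_finsum_swap[OF S.rep(1)[OF s] T.rep(1)[OF t]]) auto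
qed

section \<open>Maps between tensor products\<close>

lemmas module_tensor = two_modules.module_T[OF two_modules.intro]

lemma pure_tensor_closed:
  "\<lbrakk>module R M; module R N; a \<in> carrier M; b \<in> carrier N\<rbrakk> \<Longrightarrow>
    pure_tensor R M N a b \<in> carrier (tensor_module R M N)"
  by (rule two_modules.pure_closed[OF two_modules.intro])

lemma tensor_lift_closed:
  "\<lbrakk>t \<in> carrier (tensor_module R M N); module R M; module R N; module R P;
    \<And>a b. a \<in> carrier M \<Longrightarrow> b \<in> carrier N \<Longrightarrow> f a b \<in> carrier P\<rbrakk> \<Longrightarrow>
    tensor_lift P f t \<in> carrier P"
  by (rule two_modules.lift_closed[OF two_modules.intro])

lemma tensor_lift_cong:
  "\<lbrakk>t \<in> carrier (tensor_module R M N); module R M; module R N; module R P;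
    \<And>a b. a \<in> carrier M \<Longrightarrow> b \<in> carrier N \<Longrightarrow> f a b = g a b;
    \<And>a b. a \<in> carrier M \<Longrightarrow> b \<in> carrier N \<Longrightarrow> g a b \<in> carrier P\<rbrakk> \<Longrightarrow>
    tensor_lift P f t = tensor_lift P g t"
  by (rule two_modules.lift_cong[OF two_modules.intro])

lemma linear_pure_left:
  "\<lbrakk>f \<in> linear_maps R Q M; module R M; module R N; b \<in> carrier N\<rbrakk> \<Longrightarrow>
    (\<lambda>x. pure_tensor R M N (f x) b) \<in> linear_maps R Q (tensor_module R M N)"
  by (rule linear_maps_compose[OF two_modules.pure_linear_left[OF two_modules.intro]])

lemma linear_pure_right:
  "\<lbrakk>f \<in> linear_maps R Q N; module R M; module R N; a \<in> carrier M\<rbrakk> \<Longrightarrow>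
    (\<lambda>x. pure_tensor R M N a (f x)) \<in> linear_maps R Q (tensor_module R M N)"
  by (rule linear_maps_compose[OF two_modules.pure_linear_right[OF two_modules.intro]])

lemma linear_lift_param:
  "\<lbrakk>t \<in> carrier (tensor_module R M N); module R M; module R N; module R P;
    \<And>a b. a \<in> carrier M \<Longrightarrow> b \<in> carrier N \<Longrightarrow> (\<lambda>x. f x a b) \<in> linear_maps R Q P\<rbrakk> \<Longrightarrow>
    (\<lambda>x. tensor_lift P (f x) t) \<in> linear_maps R Q P"
  by (rule two_modules.lift_linear_param[OF two_modules.intro])

lemma linear_lift_arg:
  assumes "g \<in> linear_maps R Q (tensor_module R M N)" "module R M" "module R N" "module R P"
    "\<And>b. b \<in> carrier N \<Longrightarrow> (\<lambda>a. f a b) \<in> linear_maps R M P"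
    "\<And>a. a \<in> carrier M \<Longrightarrow> (\<lambda>b. f a b) \<in> linear_maps R N P"
  shows "(\<lambda>x. tensor_lift P f (g x)) \<in> linear_maps R Q P"
  using assms
  by (intro linear_maps_compose[OF two_modules.lift_linear[OF two_modules.intro]] bilinear_mapsI)

lemma tensor_lift_pure:
  "\<lbrakk>f \<in> bilinear_maps R M N P; module R M; module R N; module R P; a \<in> carrier M; b \<in> carrier N\<rbrakk> \<Longrightarrow>
    tensor_lift P f (pure_tensor R M N a b) = f a b"
  by (rule two_modules.lift_pure[OF two_modules.intro])

lemma tensor_lift_linear:
  "\<lbrakk>h \<in> linear_maps R P Q; t \<in> carrier (tensor_module R M N); module R M; module R N;
    module R P; module R Q;
    \<And>a b. a \<in> carrier M \<Longrightarrow> b \<in> carrier N \<Longrightarrow> f a b \<in> carrier P\<rbrakk> \<Longrightarrow>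
    h (tensor_lift P f t) = tensor_lift Q (\<lambda>a b. h (f a b)) t"
  by (rule two_modules.linear_lift[OF two_modules.intro])

lemmas tensor_lift_swap = lift_swap[OF two_modules.intro two_modules.intro]

lemmas tensor_linear_ext = two_modules.linear_ext[OF two_modules.intro]

text \<open>Meant for exhaustive resolution. A premise that determines the otherwise schematic modules comes
  first in each rule; as long as the bound variable occurs once, at most one linearity rule applies.\<close>

lemmas lin = linear_maps_ident linear_pure_left linear_pure_right linear_lift_param linear_lift_arg
  module_tensor pure_tensor_closed tensor_lift_closed bilinear_mapsI

lemma tensor_lift_bilinear:
  "\<lbrakk>f \<in> bilinear_maps R M N P; module R M; module R N; module R P\<rbrakk> \<Longrightarrow>
    (\<lambda>t. tensor_lift P f t) \<in> linear_maps R (tensor_module R M N) P"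
  by (rule two_modules.lift_linear[OF two_modules.intro])

text \<open>The lift of a bilinear \<open>h\<close> is linear and so moves through the inner sum.
  This is how a tensor that is itself given by a sum is unfolded into iterated sums.\<close>

lemma tensor_lift_lift:
  assumes h: "h \<in> bilinear_maps R K L P"
    and t: "t \<in> carrier (tensor_module R M N)"
    and mods: "module R M" "module R N" "module R K" "module R L" "module R P"
    and f: "\<And>a b. a \<in> carrier M \<Longrightarrow> b \<in> carrier N \<Longrightarrow> f a b \<in> carrier (tensor_module R K L)"
  shows "tensor_lift P h (tensor_lift (tensor_module R K L) f t) =
    tensor_lift P (\<lambda>a b. tensor_lift P h (f a b)) t"
  by (rule tensor_lift_linear[OF tensor_lift_bilinear[OF h] t]) (intro mods module_tensor f; assumption)+

text \<open>Every tensor is its own Sweedler sum. Read backwards, this introduces a sum into an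
  expression, so that a rule for lifts of bilinear maps can be applied to it.\<close>

lemma tensor_lift_pure_tensor:
  assumes "t \<in> carrier (tensor_module R M N)" "module R M" "module R N"
  shows "tensor_lift (tensor_module R M N) (pure_tensor R M N) t = t"
proof (rule tensor_linear_ext[OF assms(2,3) _ linear_maps_ident assms(1)])
  have bil: "pure_tensor R M N \<in> bilinear_maps R M N (tensor_module R M N)"
    using assms(2-) by - (rule lin | assumption)+
  show "tensor_lift (tensor_module R M N) (pure_tensor R M N)
      \<in> linear_maps R (tensor_module R M N) (tensor_module R M N)"
    using tensor_lift_bilinear[OF bil] assms(2-) module_tensor by blast
  show "tensor_lift (tensor_module R M N) (pure_tensor R M N) (pure_tensor R M N a b) =
      pure_tensor R M N a b" if "a \<in> carrier M" "b \<in> carrier N" for a b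
    using that assms(2-) by (intro tensor_lift_pure[OF bil] module_tensor)
qed

lemma tensor_map_closed:
  assumes "t \<in> carrier (tensor_module R M N)"
    "module R M" "module R N" "module R M'" "module R N'"
    "\<And>a. a \<in> carrier M \<Longrightarrow> f a \<in> carrier M'" "\<And>b. b \<in> carrier N \<Longrightarrow> g b \<in> carrier N'"
  shows "tensor_map R M' N' f g t \<in> carrier (tensor_module R M' N')"
  unfolding tensor_map_def using assms
  by - (rule tensor_lift_closed, (assumption | rule module_tensor pure_tensor_closed | blast)+)

lemma linear_tensor_map:
  assumes "module R M" "module R N" "module R M'" "module R N'"
    "f \<in> linear_maps R M M'" "g \<in> linear_maps R N N'"
  shows "(\<lambda>t. tensor_map R M' N' f g t) \<in> linear_maps R (tensor_module R M N) (tensor_module R M' N')"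
  unfolding tensor_map_def using assms
  by - (assumption | rule lin linear_mapsD(1)[OF assms(5)] linear_mapsD(1)[OF assms(6)])+

text \<open>One of three elimination rules, with \<open>tensor_lift_map2\<close> and
  \<open>tensor_mid_swap_lift\<close>: under a bilinear \<open>G\<close>, a structural map on
  tensors becomes a substitution in the arguments of \<open>G\<close>.\<close>

lemma tensor_lift_map:
  assumes G: "G \<in> bilinear_maps R M' N' P" and t: "t \<in> carrier (tensor_module R M N)"
    and mods: "module R M" "module R N" "module R M'" "module R N'" "module R P"
    and f: "\<And>a. a \<in> carrier M \<Longrightarrow> f a \<in> carrier M'" and g: "\<And>b. b \<in> carrier N \<Longrightarrow> g b \<in> carrier N'"
  shows "tensor_lift P G (tensor_map R M' N' f g t) = tensor_lift P (\<lambda>a b. G (f a) (g b)) t"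
proof -
  have "tensor_lift P G (tensor_map R M' N' f g t) =
      tensor_lift P (\<lambda>a b. tensor_lift P G (pure_tensor R M' N' (f a) (g b))) t"
    unfolding tensor_map_def
    by (rule tensor_lift_lift[OF G t]) (assumption | rule mods pure_tensor_closed f g)+
  also have "\<dots> = tensor_lift P (\<lambda>a b. G (f a) (g b)) t"
    by (rule tensor_lift_cong[OF t])
      (assumption | rule mods tensor_lift_pure[OF G] bilinear_mapsD(3)[OF G] f g)+
  finally show ?thesis .
qed

lemma tensor_lift_map2:
  assumes G: "G \<in> bilinear_maps R K L P"
    and s: "s \<in> carrier (tensor_module R M N)" and t: "t \<in> carrier (tensor_module R M' N')"
    and mods: "module R M" "module R N" "module R M'" "module R N'" "module R K" "module R L" "module R P"
    and f: "\<And>a c. a \<in> carrier M \<Longrightarrow> c \<in> carrier M' \<Longrightarrow> f a c \<in> carrier K"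
    and g: "\<And>b d. b \<in> carrier N \<Longrightarrow> d \<in> carrier N' \<Longrightarrow> g b d \<in> carrier L"
  shows "tensor_lift P G (tensor_map2 R K L f g s t) =
    tensor_lift P (\<lambda>a b. tensor_lift P (\<lambda>c d. G (f a c) (g b d)) t) s"
proof -
  have "tensor_lift P G (tensor_map2 R K L f g s t) =
      tensor_lift P (\<lambda>a b. tensor_lift P G (tensor_lift (tensor_module R K L)
        (\<lambda>c d. pure_tensor R K L (f a c) (g b d)) t)) s"
    unfolding tensor_map2_def
    by (rule tensor_lift_lift[OF G s])
      (assumption | rule mods pure_tensor_closed f g tensor_lift_closed[OF t] module_tensor)+
  also have "\<dots> = tensor_lift P (\<lambda>a b. tensor_lift P (\<lambda>c d. tensor_lift P G
        (pure_tensor R K L (f a c) (g b d))) t) s"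
    by (rule tensor_lift_cong[OF s], (rule mods)+, rule tensor_lift_lift[OF G t])
      (assumption | rule mods pure_tensor_closed f g tensor_lift_closed[OF t] module_tensor
        linear_mapsD(1)[OF tensor_lift_bilinear[OF G]])+
  also have "\<dots> = tensor_lift P (\<lambda>a b. tensor_lift P (\<lambda>c d. G (f a c) (g b d)) t) s"
    by (rule tensor_lift_cong[OF s], (rule mods)+, rule tensor_lift_cong[OF t])
      (assumption | rule mods tensor_lift_closed[OF t] tensor_lift_pure[OF G] bilinear_mapsD(3)[OF G] f g)+
  finally show ?thesis .
qed

lemma tensor_map2_closed:
  assumes "s \<in> carrier (tensor_module R M N)" "t \<in> carrier (tensor_module R M' N')"
    "module R M" "module R N" "module R M'" "module R N'" "module R K" "module R L"
    and f: "\<And>a c. a \<in> carrier M \<Longrightarrow> c \<in> carrier M' \<Longrightarrow> f a c \<in> carrier K"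
    and g: "\<And>b d. b \<in> carrier N \<Longrightarrow> d \<in> carrier N' \<Longrightarrow> g b d \<in> carrier L"
  shows "tensor_map2 R K L f g s t \<in> carrier (tensor_module R K L)"
  unfolding tensor_map2_def using assms(1-8)
  by - (assumption | rule tensor_lift_closed module_tensor pure_tensor_closed f g)+

text \<open>For an abstract \<open>G\<close> the linearity rules have to see through its arguments;
  instantiated with \<open>G\<close>, this rule and the next reduce the goal to linearity of the
  argument.\<close>

lemma bilinear_compose_left:
  "\<lbrakk>G \<in> bilinear_maps R M N P; f \<in> linear_maps R Q M; b \<in> carrier N\<rbrakk> \<Longrightarrow>
    (\<lambda>x. G (f x) b) \<in> linear_maps R Q P"
  by (rule linear_maps_compose[OF bilinear_mapsD(1)])

lemma bilinear_compose_right: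
  "\<lbrakk>G \<in> bilinear_maps R M N P; f \<in> linear_maps R Q N; a \<in> carrier M\<rbrakk> \<Longrightarrow>
    (\<lambda>x. G a (f x)) \<in> linear_maps R Q P"
  by (rule linear_maps_compose[OF bilinear_mapsD(2)])

lemma tensor_mid_swap_lift:
  assumes G: "G \<in> bilinear_maps R (tensor_module R A C) (tensor_module R B D) P"
    and u: "u \<in> carrier (tensor_module R (tensor_module R A B) (tensor_module R C D))"
    and mods: "module R A" "module R B" "module R C" "module R D" "module R P"
  shows "tensor_lift P G (tensor_mid_swap R A B C D u) =
    tensor_lift P (\<lambda>s t. tensor_lift P (\<lambda>a b. tensor_lift P (\<lambda>c d.
      G (pure_tensor R A C a c) (pure_tensor R B D b d)) t) s) u"
proof -
  note cl = mods bilinear_mapsD(3)[OF G] linear_mapsD(1)[OF tensor_lift_bilinear[OF G]]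
    tensor_map2_closed lin
  have "tensor_lift P G (tensor_mid_swap R A B C D u) =
      tensor_lift P (\<lambda>s t. tensor_lift P G (tensor_map2 R (tensor_module R A C) (tensor_module R B D)
        (pure_tensor R A C) (pure_tensor R B D) s t)) u"
    unfolding tensor_mid_swap_def Let_def
    by (rule tensor_lift_lift[OF G u]) (assumption | rule cl)+
  also have "\<dots> = tensor_lift P (\<lambda>s t. tensor_lift P (\<lambda>a b. tensor_lift P (\<lambda>c d.
      G (pure_tensor R A C a c) (pure_tensor R B D b d)) t) s) u"
    by (rule tensor_lift_cong[OF u], (rule cl)+, rule tensor_lift_map2[OF G])
      (assumption | rule cl)+
  finally show ?thesis .
qed

lemma linear_tensor_mid_swap:
  assumes mods: "module R A" "module R B" "module R C" "module R D"
  shows "(\<lambda>u. tensor_mid_swap R A B C D u) \<in> linear_maps R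
    (tensor_module R (tensor_module R A B) (tensor_module R C D))
    (tensor_module R (tensor_module R A C) (tensor_module R B D))"
  unfolding tensor_mid_swap_def Let_def tensor_map2_def
  by (assumption | rule mods lin)+

section \<open>The base ring as a module over itself\<close>

lemma finsum_regular_module: "finsum (regular_module R) f A = finsum R f A"
  by (simp add: finsum_def finprod_def regular_module_def)

lemma add_pow_regular_module:
  fixes n :: int
  shows "add_pow (regular_module R) n x = add_pow R n x"
  by (simp add: add_pow_def int_pow_def2 nat_pow_def m_inv_def regular_module_def)

text \<open>\<open>square_counit\<close> sums in the ring, while the linearity rules want a module
  as target. Sums depend only on the additive structure, where the two records agree.\<close>

lemma tensor_lift_regular_module: "tensor_lift (regular_module R) = tensor_lift R"
  by (intro ext) (simp add: tensor_lift_def finsum_regular_module add_pow_regular_module Let_def)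

lemma regular_module_simps [simp]:
  "carrier (regular_module R) = carrier R"
  "x \<oplus>\<^bsub>regular_module R\<^esub> y = x \<oplus>\<^bsub>R\<^esub> y"
  "r \<odot>\<^bsub>regular_module R\<^esub> y = r \<otimes>\<^bsub>R\<^esub> y"
  "\<zero>\<^bsub>regular_module R\<^esub> = \<zero>\<^bsub>R\<^esub>"
  by (simp_all add: regular_module_def)

lemma (in cring) module_regular: "module R (regular_module R)"
proof (rule moduleI[OF is_cring])
  show "abelian_group (regular_module R)"
  proof (rule abelian_groupI)
    show "\<exists>y\<in>carrier (regular_module R). y \<oplus>\<^bsub>regular_module R\<^esub> x = \<zero>\<^bsub>regular_module R\<^esub>"
      if "x \<in> carrier (regular_module R)" for x
      using that by (intro bexI[of _ "\<ominus> x"]) (simp_all add: l_neg)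
  qed (simp_all add: a_ac)
qed (simp_all add: m_assoc l_distr r_distr)

lemma (in module) linear_smult_left:
  assumes "f \<in> linear_maps R Q (regular_module R)" "x \<in> carrier M"
  shows "(\<lambda>q. f q \<odot>\<^bsub>M\<^esub> x) \<in> linear_maps R Q M"
  using assms by (auto simp: linear_maps_def Pi_iff smult_l_distr smult_assoc1)

lemma (in module) linear_smult_right:
  assumes "f \<in> linear_maps R Q M" "r \<in> carrier R"
  shows "(\<lambda>q. r \<odot>\<^bsub>M\<^esub> f q) \<in> linear_maps R Q M"
  using linear_maps_compose[OF linear_maps_smult[OF module_axioms assms(2)] assms(1)] .

lemma (in cring) linear_mult_left:
  assumes "f \<in> linear_maps R Q (regular_module R)" "x \<in> carrier R"
  shows "(\<lambda>q. f q \<otimes> x) \<in> linear_maps R Q (regular_module R)"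
  using module.linear_smult_left[OF module_regular assms(1), of x] assms(2) by simp

lemma (in cring) linear_mult_right:
  assumes "f \<in> linear_maps R Q (regular_module R)" "r \<in> carrier R"
  shows "(\<lambda>q. r \<otimes> f q) \<in> linear_maps R Q (regular_module R)"
  using module.linear_smult_right[OF module_regular assms] by simp

section \<open>The tensor square of a coalgebra\<close>

context coalgebra
begin

abbreviation "CC \<equiv> tensor_module R C C"

lemma comult_closed: "x \<in> carrier C \<Longrightarrow> \<Delta> x \<in> carrier CC"
  by (rule linear_mapsD(1)[OF comult_linear])

lemma linear_comult: "g \<in> linear_maps R Q C \<Longrightarrow> (\<lambda>x. \<Delta> (g x)) \<in> linear_maps R Q CC"
  by (rule linear_maps_compose[OF comult_linear])

lemmas clin = comult_closed linear_comult module_axioms lin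

text \<open>In Sweedler notation, both sides are the sum of \<open>F x(1) x(2) x(3)\<close>.\<close>

lemma coassoc_lift:
  assumes x: "x \<in> carrier C" and P: "module R P"
    and F: "\<And>b c. \<lbrakk>b \<in> carrier C; c \<in> carrier C\<rbrakk> \<Longrightarrow> (\<lambda>a. F a b c) \<in> linear_maps R C P"
    "\<And>a c. \<lbrakk>a \<in> carrier C; c \<in> carrier C\<rbrakk> \<Longrightarrow> (\<lambda>b. F a b c) \<in> linear_maps R C P"
    "\<And>a b. \<lbrakk>a \<in> carrier C; b \<in> carrier C\<rbrakk> \<Longrightarrow> (\<lambda>c. F a b c) \<in> linear_maps R C P"
  shows "tensor_lift P (\<lambda>y c. tensor_lift P (\<lambda>a b. F a b c) (\<Delta> y)) (\<Delta> x) =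
    tensor_lift P (\<lambda>a y. tensor_lift P (\<lambda>b c. F a b c) (\<Delta> y)) (\<Delta> x)"
proof -
  let ?G = "\<lambda>a s. tensor_lift P (\<lambda>b c. F a b c) s"
  let ?CCC = "tensor_module R C CC"
  note Fcl = linear_mapsD(1)[OF F(3)]
  note cl = F Fcl P clin
  \<comment> \<open>\<open>?G\<close> is \<open>F\<close> read as a bilinear map on C and C
    \<otimes> C. Its lift, applied to both sides of \<open>coassoc\<close>, gives the two iterated
    sums.\<close>
  have G: "?G \<in> bilinear_maps R C CC P"
    by (assumption | rule cl)+
  have assocG: "tensor_lift P ?G (tensor_assoc R C C C u) =
      tensor_lift P (\<lambda>s c. tensor_lift P (\<lambda>a b. F a b c) s) u"
    if u: "u \<in> carrier (tensor_module R CC C)" for u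
  proof -
    have "tensor_lift P ?G (tensor_assoc R C C C u) = tensor_lift P (\<lambda>s c. tensor_lift P ?G
        (tensor_lift ?CCC (\<lambda>a b. pure_tensor R C CC a (pure_tensor R C C b c)) s)) u"
      unfolding tensor_assoc_def Let_def
      by (rule tensor_lift_lift[OF G u]) (assumption | rule cl)+
    also have "\<dots> = tensor_lift P (\<lambda>s c. tensor_lift P (\<lambda>a b. tensor_lift P ?G
        (pure_tensor R C CC a (pure_tensor R C C b c))) s) u"
      by (rule tensor_lift_cong[OF u], (rule cl)+, rule tensor_lift_lift[OF G])
       (assumption | rule cl)+
    also have "\<dots> = tensor_lift P (\<lambda>s c. tensor_lift P (\<lambda>a b. F a b c) s) u"
    proof (rule tensor_lift_cong[OF u], (rule cl)+, rule tensor_lift_cong)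
      fix s a b c assume abc: "a \<in> carrier C" "b \<in> carrier C" "c \<in> carrier C"
      have Fa: "F a \<in> bilinear_maps R C C P"
        using abc by - (assumption | rule cl)+
      have "tensor_lift P ?G (pure_tensor R C CC a (pure_tensor R C C b c)) =
          tensor_lift P (F a) (pure_tensor R C C b c)"
        using abc by (intro tensor_lift_pure[OF G]) (assumption | rule cl)+
      also have "\<dots> = F a b c"
        using abc by (intro tensor_lift_pure[OF Fa]) (assumption | rule cl)+
      finally show "tensor_lift P ?G (pure_tensor R C CC a (pure_tensor R C C b c)) = F a b c" .
    qed (assumption | rule cl)+
    finally show ?thesis .
  qed
  \<comment> \<open>The factor \<open>id\<close> of the axiom \<open>coassoc\<close> is written out
    so that \<open>tensor_lift_map\<close> matches.\<close>
  have "tensor_lift P (\<lambda>y c. tensor_lift P (\<lambda>a b. F a b c) (\<Delta> y)) (\<Delta> x) =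
      tensor_lift P (\<lambda>y c. tensor_lift P (\<lambda>a b. F a b (id c)) (\<Delta> y)) (\<Delta> x)" by simp
  also have "\<dots> = tensor_lift P (\<lambda>s c. tensor_lift P (\<lambda>a b. F a b c) s) (tensor_map R CC C \<Delta> id (\<Delta> x))"
    using x by (intro tensor_lift_map[symmetric, where M = C and N = C]) (assumption | rule cl | simp)+
  also have "\<dots> = tensor_lift P ?G (tensor_assoc R C C C (tensor_map R CC C \<Delta> id (\<Delta> x)))"
    using x by (intro assocG[symmetric] tensor_map_closed[where M = C and N = C]) (assumption | rule cl | simp)+
  also have "\<dots> = tensor_lift P ?G (tensor_map R C CC id \<Delta> (\<Delta> x))"
    by (simp add: coassoc[OF x])
  also have "\<dots> = tensor_lift P (\<lambda>a y. ?G (id a) (\<Delta> y)) (\<Delta> x)"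
    using x by (intro tensor_lift_map[OF G, where M = C and N = C]) (assumption | rule cl | simp)+
  finally show ?thesis by simp
qed

section \<open>The comultiplication of the tensor square\<close>

abbreviation "pure \<equiv> pure_tensor R C C"
abbreviation "\<Delta>\<^sub>Y \<equiv> square_comult R C \<Delta>"
abbreviation "YY \<equiv> tensor_module R CC CC"

lemma module_CC: "module R CC"
  by (rule module_tensor[OF module_axioms module_axioms])

lemma square_comult_linear: "\<Delta>\<^sub>Y \<in> linear_maps R CC YY"
  unfolding square_comult_def
  by (rule linear_maps_compose[OF linear_tensor_mid_swap linear_tensor_map])
    (rule comult_linear clin)+

lemma square_comult_closed: "y \<in> carrier CC \<Longrightarrow> \<Delta>\<^sub>Y y \<in> carrier YY"
  by (rule linear_mapsD(1)[OF square_comult_linear])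

lemma linear_square_comult: "g \<in> linear_maps R Q CC \<Longrightarrow> (\<lambda>x. \<Delta>\<^sub>Y (g x)) \<in> linear_maps R Q YY"
  by (rule linear_maps_compose[OF square_comult_linear])

text \<open>The middle swap pairs first legs with first legs: a term x \<otimes> x' of
  \<open>y\<close> contributes G (x(1) \<otimes> x'(1)) (x(2) \<otimes> x'(2)). The swap is
  eliminated first, then the tensor product of the two comultiplications.\<close>

lemma lift_square_comult:
  assumes G: "G \<in> bilinear_maps R CC CC P" and P: "module R P" and y: "y \<in> carrier CC"
  shows "tensor_lift P G (\<Delta>\<^sub>Y y) = tensor_lift P (\<lambda>x x'. tensor_lift P (\<lambda>a b.
    tensor_lift P (\<lambda>c d. G (pure a c) (pure b d)) (\<Delta> x')) (\<Delta> x)) y"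
proof -
  note cl = bilinear_mapsD(3)[OF G] P bilinear_compose_left[OF G] bilinear_compose_right[OF G] clin
  have "tensor_lift P G (\<Delta>\<^sub>Y y) = tensor_lift P (\<lambda>s t. tensor_lift P (\<lambda>a b.
      tensor_lift P (\<lambda>c d. G (pure a c) (pure b d)) t) s) (tensor_map R CC CC \<Delta> \<Delta> y)"
    unfolding square_comult_def
    using y by (intro tensor_mid_swap_lift[OF G] tensor_map_closed[where M = C and N = C])
      (assumption | rule cl)+
  also have "\<dots> = tensor_lift P (\<lambda>x x'. tensor_lift P (\<lambda>a b.
      tensor_lift P (\<lambda>c d. G (pure a c) (pure b d)) (\<Delta> x')) (\<Delta> x)) y"
    using y by (intro tensor_lift_map[where M = C and N = C]) (assumption | rule cl)+
  finally show ?thesis .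
qed

lemma lift_square_comult_pure:
  assumes G: "G \<in> bilinear_maps R CC CC P" and P: "module R P"
    and x: "x \<in> carrier C" "x' \<in> carrier C"
  shows "tensor_lift P G (\<Delta>\<^sub>Y (pure x x')) = tensor_lift P (\<lambda>a b.
    tensor_lift P (\<lambda>c d. G (pure a c) (pure b d)) (\<Delta> x')) (\<Delta> x)"
proof -
  note cl = bilinear_mapsD(3)[OF G] P bilinear_compose_left[OF G] bilinear_compose_right[OF G] clin
  let ?g = "\<lambda>x x'. tensor_lift P (\<lambda>a b. tensor_lift P (\<lambda>c d. G (pure a c) (pure b d)) (\<Delta> x')) (\<Delta> x)"
  have g: "?g \<in> bilinear_maps R C C P"
    by (assumption | rule cl)+
  show ?thesis
    using x by (subst lift_square_comult[OF G P pure_tensor_closed[OF module_axioms module_axioms x]])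
      (rule tensor_lift_pure[OF g module_axioms module_axioms P])
qed

text \<open>This is coassociativity for \<open>x\<close> and for \<open>x'\<close> separately. Their
  sums interleave, so independent sums are exchanged to bring each nested coproduct next to its
  parent, and exchanged again after the two uses of \<open>coassoc_lift\<close>.\<close>

lemma coassoc_swapped:
  assumes P: "module R P" and x: "x \<in> carrier C" "x' \<in> carrier C"
    and F: "\<And>b c. \<lbrakk>b \<in> carrier CC; c \<in> carrier CC\<rbrakk> \<Longrightarrow> (\<lambda>a. F a b c) \<in> linear_maps R CC P"
    "\<And>a c. \<lbrakk>a \<in> carrier CC; c \<in> carrier CC\<rbrakk> \<Longrightarrow> (\<lambda>b. F a b c) \<in> linear_maps R CC P"
    "\<And>a b. \<lbrakk>a \<in> carrier CC; b \<in> carrier CC\<rbrakk> \<Longrightarrow> (\<lambda>c. F a b c) \<in> linear_maps R CC P"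
  shows "tensor_lift P (\<lambda>y b. tensor_lift P (\<lambda>y' d. tensor_lift P (\<lambda>a a'. tensor_lift P (\<lambda>c c'.
      F (pure a c) (pure a' c') (pure b d)) (\<Delta> y')) (\<Delta> y)) (\<Delta> x')) (\<Delta> x) =
    tensor_lift P (\<lambda>a y. tensor_lift P (\<lambda>c y'. tensor_lift P (\<lambda>a' b. tensor_lift P (\<lambda>c' d.
      F (pure a c) (pure a' c') (pure b d)) (\<Delta> y')) (\<Delta> y)) (\<Delta> x')) (\<Delta> x)"
    (is "?lhs = ?rhs")
proof -
  \<comment> \<open>\<open>F\<close> occurs applied to pure tensors; composed with an arbitrary
    inner linear map, its linearity matches such terms.\<close>
  note Flin = linear_maps_compose[OF F(1)] linear_maps_compose[OF F(2)] linear_maps_compose[OF F(3)]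
  note Fcl = linear_mapsD(1)[OF F(3)]
  note cl = x P Flin Fcl clin
  let ?K = "\<lambda>a a' b c c' d. F (pure a c) (pure a' c') (pure b d)"
  have "?lhs = tensor_lift P (\<lambda>y b. tensor_lift P (\<lambda>a a'. tensor_lift P (\<lambda>y' d. tensor_lift P (\<lambda>c c'.
      ?K a a' b c c' d) (\<Delta> y')) (\<Delta> x')) (\<Delta> y)) (\<Delta> x)"
    by (rule tensor_lift_cong[where M = C and N = C], (rule cl)+,
        rule tensor_lift_swap[where M = C and N = C and M' = C and N' = C]) (assumption | rule cl)+
  also have "\<dots> = tensor_lift P (\<lambda>y b. tensor_lift P (\<lambda>a a'. tensor_lift P (\<lambda>c y'. tensor_lift P (\<lambda>c' d.
      ?K a a' b c c' d) (\<Delta> y')) (\<Delta> x')) (\<Delta> y)) (\<Delta> x)"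
    by (rule tensor_lift_cong[where M = C and N = C], (rule cl)+,
        rule tensor_lift_cong[where M = C and N = C], (assumption | rule cl)+,
        rule coassoc_lift) (assumption | rule cl)+
  also have "\<dots> = tensor_lift P (\<lambda>a y. tensor_lift P (\<lambda>a' b. tensor_lift P (\<lambda>c y'. tensor_lift P (\<lambda>c' d.
      ?K a a' b c c' d) (\<Delta> y')) (\<Delta> x')) (\<Delta> y)) (\<Delta> x)"
    by (rule coassoc_lift) (assumption | rule cl)+
  also have "\<dots> = ?rhs"
    by (rule tensor_lift_cong[where M = C and N = C], (rule cl)+,
        rule tensor_lift_swap[where M = C and N = C and M' = C and N' = C]) (assumption | rule cl)+
  finally show ?thesis .
qed

lemma square_coassoc_lift:
  assumes P: "module R P" and y: "y \<in> carrier CC"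
    and F: "\<And>b c. \<lbrakk>b \<in> carrier CC; c \<in> carrier CC\<rbrakk> \<Longrightarrow> (\<lambda>a. F a b c) \<in> linear_maps R CC P"
    "\<And>a c. \<lbrakk>a \<in> carrier CC; c \<in> carrier CC\<rbrakk> \<Longrightarrow> (\<lambda>b. F a b c) \<in> linear_maps R CC P"
    "\<And>a b. \<lbrakk>a \<in> carrier CC; b \<in> carrier CC\<rbrakk> \<Longrightarrow> (\<lambda>c. F a b c) \<in> linear_maps R CC P"
  shows "tensor_lift P (\<lambda>z c. tensor_lift P (\<lambda>a b. F a b c) (\<Delta>\<^sub>Y z)) (\<Delta>\<^sub>Y y) =
    tensor_lift P (\<lambda>a z. tensor_lift P (\<lambda>b c. F a b c) (\<Delta>\<^sub>Y z)) (\<Delta>\<^sub>Y y)" (is "?L y = ?R y")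
proof (rule tensor_linear_ext[OF module_axioms module_axioms _ _ y])
  note Flin = linear_maps_compose[OF F(1)] linear_maps_compose[OF F(2)] linear_maps_compose[OF F(3)]
  note Fcl = linear_mapsD(1)[OF F(3)]
  note cl = P Flin Fcl square_comult_closed linear_square_comult clin
  show "?L \<in> linear_maps R CC P" "?R \<in> linear_maps R CC P"
    by (assumption | rule cl)+
  fix x x' assume x: "x \<in> carrier C" "x' \<in> carrier C"
  have bil: "(\<lambda>a b. F a b c) \<in> bilinear_maps R CC CC P" "(\<lambda>a b. F c a b) \<in> bilinear_maps R CC CC P"
    if "c \<in> carrier CC" for c
    using that by - (assumption | rule cl)+
  have "?L (pure x x') = tensor_lift P (\<lambda>y b. tensor_lift P (\<lambda>y' d.
      tensor_lift P (\<lambda>a b'. F a b' (pure b d)) (\<Delta>\<^sub>Y (pure y y'))) (\<Delta> x')) (\<Delta> x)"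
    by (rule lift_square_comult_pure[OF _ P x]) (assumption | rule cl)+
  also have "\<dots> = tensor_lift P (\<lambda>y b. tensor_lift P (\<lambda>y' d. tensor_lift P (\<lambda>a a'. tensor_lift P (\<lambda>c c'.
      F (pure a c) (pure a' c') (pure b d)) (\<Delta> y')) (\<Delta> y)) (\<Delta> x')) (\<Delta> x)"
    by (rule tensor_lift_cong[where M = C and N = C], (rule cl x)+,
        rule tensor_lift_cong[where M = C and N = C], (assumption | rule cl x)+,
        rule lift_square_comult_pure[OF bil(1) P]) (assumption | rule cl x)+
  also have "\<dots> = tensor_lift P (\<lambda>a y. tensor_lift P (\<lambda>c y'. tensor_lift P (\<lambda>a' b. tensor_lift P (\<lambda>c' d.
      F (pure a c) (pure a' c') (pure b d)) (\<Delta> y')) (\<Delta> y)) (\<Delta> x')) (\<Delta> x)"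
    by (rule coassoc_swapped[OF P x F])
  also have "\<dots> = tensor_lift P (\<lambda>a y. tensor_lift P (\<lambda>c y'.
      tensor_lift P (\<lambda>b b'. F (pure a c) b b') (\<Delta>\<^sub>Y (pure y y'))) (\<Delta> x')) (\<Delta> x)"
    by (rule tensor_lift_cong[where M = C and N = C], (rule cl x)+,
        rule tensor_lift_cong[where M = C and N = C], (assumption | rule cl x)+,
        rule lift_square_comult_pure[OF bil(2) P, symmetric]) (assumption | rule cl x)+
  also have "\<dots> = ?R (pure x x')"
    by (rule lift_square_comult_pure[OF _ P x, symmetric]) (assumption | rule cl)+
  finally show "?L (pure x x') = ?R (pure x x')" .
qed

text \<open>In \<open>square_coassoc_lift\<close> the trilinear map is taken to be the universal
  one, which sends a, b, c to a \<otimes> (b \<otimes> c). This turns the equality of iterated sums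
  back into the coalgebra axiom.\<close>

lemma square_coassoc:
  assumes y: "y \<in> carrier CC"
  shows "tensor_assoc R CC CC CC (tensor_map R YY CC \<Delta>\<^sub>Y id (\<Delta>\<^sub>Y y)) =
    tensor_map R CC YY id \<Delta>\<^sub>Y (\<Delta>\<^sub>Y y)"
proof -
  let ?P = "tensor_module R CC YY"
  let ?F = "\<lambda>a b c. pure_tensor R CC YY a (pure_tensor R CC CC b c)"
  note cl = module_CC y square_comult_closed linear_square_comult clin
  have "tensor_assoc R CC CC CC (tensor_map R YY CC \<Delta>\<^sub>Y id (\<Delta>\<^sub>Y y)) =
      tensor_lift ?P (\<lambda>z c. tensor_lift ?P (\<lambda>a b. ?F a b (id c)) (\<Delta>\<^sub>Y z)) (\<Delta>\<^sub>Y y)"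
    unfolding tensor_assoc_def Let_def
    by (rule tensor_lift_map[where M = CC and N = CC]) (assumption | rule cl | simp)+
  also have "\<dots> = tensor_lift ?P (\<lambda>z c. tensor_lift ?P (\<lambda>a b. ?F a b c) (\<Delta>\<^sub>Y z)) (\<Delta>\<^sub>Y y)"
    by simp
  also have "\<dots> = tensor_lift ?P (\<lambda>a z. tensor_lift ?P (\<lambda>b c. ?F a b c) (\<Delta>\<^sub>Y z)) (\<Delta>\<^sub>Y y)"
    by (rule square_coassoc_lift) (assumption | rule cl)+
  also have "\<dots> = tensor_lift ?P (\<lambda>a z. pure_tensor R CC YY (id a) (\<Delta>\<^sub>Y z)) (\<Delta>\<^sub>Y y)"
  proof (rule tensor_lift_cong[where M = CC and N = CC])
    fix a z assume az: "a \<in> carrier CC" "z \<in> carrier CC"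
    \<comment> \<open>The inner sum moves into the second slot, where it is the Sweedler sum of
      \<open>\<Delta>\<^sub>Y z\<close>.\<close>
    have "pure_tensor R CC YY a (tensor_lift YY (pure_tensor R CC CC) (\<Delta>\<^sub>Y z)) =
        tensor_lift ?P (\<lambda>b c. ?F a b c) (\<Delta>\<^sub>Y z)"
      using az by (intro tensor_lift_linear[where M = CC and N = CC and P = YY and h = "pure_tensor R CC YY a"])
        (assumption | rule cl)+
    moreover have "tensor_lift YY (pure_tensor R CC CC) (\<Delta>\<^sub>Y z) = \<Delta>\<^sub>Y z"
      using az by (intro tensor_lift_pure_tensor) (assumption | rule cl)+
    ultimately show "tensor_lift ?P (\<lambda>b c. ?F a b c) (\<Delta>\<^sub>Y z) = pure_tensor R CC YY (id a) (\<Delta>\<^sub>Y z)"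
      by simp
  qed (unfold id_apply, (assumption | rule cl)+)
  also have "\<dots> = tensor_map R CC YY id \<Delta>\<^sub>Y (\<Delta>\<^sub>Y y)"
    by (simp add: tensor_map_def)
  finally show ?thesis .
qed

section \<open>The counit of the tensor square\<close>

abbreviation "\<epsilon>\<^sub>Y \<equiv> square_counit R \<epsilon>"

lemma counit_closed: "x \<in> carrier C \<Longrightarrow> \<epsilon> x \<in> carrier R"
  using linear_mapsD(1)[OF counit_linear] by simp

lemma linear_counit: "g \<in> linear_maps R Q C \<Longrightarrow> (\<lambda>x. \<epsilon> (g x)) \<in> linear_maps R Q (regular_module R)"
  by (rule linear_maps_compose[OF counit_linear])

lemmas counit_lin = counit_closed linear_counit linear_mult_left linear_mult_right module_regular
  linear_smult_left linear_smult_right clin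

lemma square_counit_linear: "\<epsilon>\<^sub>Y \<in> linear_maps R CC (regular_module R)"
proof -
  have "(\<lambda>y. tensor_lift (regular_module R) (\<lambda>a b. \<epsilon> a \<otimes>\<^bsub>R\<^esub> \<epsilon> b) y) \<in> linear_maps R CC (regular_module R)"
    by (assumption | rule counit_lin)+
  then show ?thesis by (simp add: square_counit_def tensor_lift_regular_module)
qed

lemma square_counit_pure:
  assumes "x \<in> carrier C" "x' \<in> carrier C"
  shows "\<epsilon>\<^sub>Y (pure x x') = \<epsilon> x \<otimes>\<^bsub>R\<^esub> \<epsilon> x'"
proof -
  have "tensor_lift (regular_module R) (\<lambda>a b. \<epsilon> a \<otimes>\<^bsub>R\<^esub> \<epsilon> b) (pure x x') = \<epsilon> x \<otimes>\<^bsub>R\<^esub> \<epsilon> x'"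
    using assms by (intro tensor_lift_pure) (assumption | rule counit_lin)+
  then show ?thesis by (simp add: square_counit_def tensor_lift_regular_module)
qed

lemma square_counit_closed: "y \<in> carrier CC \<Longrightarrow> \<epsilon>\<^sub>Y y \<in> carrier R"
  using linear_mapsD(1)[OF square_counit_linear] by simp

lemma linear_square_counit:
  "g \<in> linear_maps R Q CC \<Longrightarrow> (\<lambda>x. \<epsilon>\<^sub>Y (g x)) \<in> linear_maps R Q (regular_module R)"
  by (rule linear_maps_compose[OF square_counit_linear])

text \<open>Distributes the scalar over the two factors, so that each slot carries its own instance
  of a counit axiom of \<open>C\<close>.\<close>

lemma square_counit_smult_pure:
  assumes "a \<in> carrier C" "b \<in> carrier C" "c \<in> carrier C" "d \<in> carrier C"
  shows "\<epsilon>\<^sub>Y (pure a c) \<odot>\<^bsub>CC\<^esub> pure b d = pure (\<epsilon> a \<odot>\<^bsub>C\<^esub> b) (\<epsilon> c \<odot>\<^bsub>C\<^esub> d)"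
proof -
  interpret two_modules R C C by (intro two_modules.intro module_axioms)
  show ?thesis
    using assms by (simp add: square_counit_pure m_comm[of "\<epsilon> a" "\<epsilon> c"] T.smult_assoc1 counit_closed pure_closed
        pure_smult_left pure_smult_right)
qed

lemma square_counit_left:
  assumes y: "y \<in> carrier CC"
  shows "tensor_lift CC (\<lambda>s t. \<epsilon>\<^sub>Y s \<odot>\<^bsub>CC\<^esub> t) (\<Delta>\<^sub>Y y) = y" (is "?L y = y")
proof (rule tensor_linear_ext[OF module_axioms module_axioms _ linear_maps_ident y])
  note cl = square_comult_closed linear_square_comult module.linear_smult_left[OF module_CC]
    module.linear_smult_right[OF module_CC] square_counit_closed linear_square_counit
    smult_closed module.smult_closed[OF module_CC] module_CC counit_lin
  show "?L \<in> linear_maps R CC CC"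
    by (assumption | rule cl)+
  fix x x' assume x: "x \<in> carrier C" "x' \<in> carrier C"
  have "?L (pure x x') = tensor_lift CC (\<lambda>a b. tensor_lift CC (\<lambda>c d.
      \<epsilon>\<^sub>Y (pure a c) \<odot>\<^bsub>CC\<^esub> pure b d) (\<Delta> x')) (\<Delta> x)"
    by (rule lift_square_comult_pure[OF _ module_CC x]) (assumption | rule cl)+
  also have "\<dots> = tensor_lift CC (\<lambda>a b. tensor_lift CC (\<lambda>c d.
      pure (\<epsilon> a \<odot>\<^bsub>C\<^esub> b) (\<epsilon> c \<odot>\<^bsub>C\<^esub> d)) (\<Delta> x')) (\<Delta> x)"
    by (rule tensor_lift_cong[where M = C and N = C], (rule cl x)+,
        rule tensor_lift_cong[where M = C and N = C], (assumption | rule cl x)+,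
        rule square_counit_smult_pure) (assumption | rule cl x)+
  also have "\<dots> = tensor_lift CC (\<lambda>a b.
      pure (\<epsilon> a \<odot>\<^bsub>C\<^esub> b) (tensor_lift C (\<lambda>c d. \<epsilon> c \<odot>\<^bsub>C\<^esub> d) (\<Delta> x'))) (\<Delta> x)"
    by (rule tensor_lift_cong[where M = C and N = C], (rule cl x)+,
        rule tensor_lift_linear[where M = C and N = C and P = C, symmetric]) (assumption | rule cl x)+
  also have "\<dots> = tensor_lift CC (\<lambda>a b. pure (\<epsilon> a \<odot>\<^bsub>C\<^esub> b) x') (\<Delta> x)"
    by (simp only: counit_left[OF x(2)])
  also have "\<dots> = pure (tensor_lift C (\<lambda>a b. \<epsilon> a \<odot>\<^bsub>C\<^esub> b) (\<Delta> x)) x'"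
    by (rule tensor_lift_linear[where M = C and N = C and P = C and h = "\<lambda>z. pure z x'", symmetric])
      (assumption | rule cl x)+
  also have "\<dots> = pure x x'"
    by (simp only: counit_left[OF x(1)])
  finally show "?L (pure x x') = pure x x'" .
qed

lemma square_counit_right:
  assumes y: "y \<in> carrier CC"
  shows "tensor_lift CC (\<lambda>s t. \<epsilon>\<^sub>Y t \<odot>\<^bsub>CC\<^esub> s) (\<Delta>\<^sub>Y y) = y" (is "?L y = y")
proof (rule tensor_linear_ext[OF module_axioms module_axioms _ linear_maps_ident y])
  note cl = square_comult_closed linear_square_comult module.linear_smult_left[OF module_CC]
    module.linear_smult_right[OF module_CC] square_counit_closed linear_square_counit
    smult_closed module.smult_closed[OF module_CC] module_CC counit_lin
  show "?L \<in> linear_maps R CC CC"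
    by (assumption | rule cl)+
  fix x x' assume x: "x \<in> carrier C" "x' \<in> carrier C"
  have "?L (pure x x') = tensor_lift CC (\<lambda>a b. tensor_lift CC (\<lambda>c d.
      \<epsilon>\<^sub>Y (pure b d) \<odot>\<^bsub>CC\<^esub> pure a c) (\<Delta> x')) (\<Delta> x)"
    by (rule lift_square_comult_pure[OF _ module_CC x]) (assumption | rule cl)+
  also have "\<dots> = tensor_lift CC (\<lambda>a b. tensor_lift CC (\<lambda>c d.
      pure (\<epsilon> b \<odot>\<^bsub>C\<^esub> a) (\<epsilon> d \<odot>\<^bsub>C\<^esub> c)) (\<Delta> x')) (\<Delta> x)"
    by (rule tensor_lift_cong[where M = C and N = C], (rule cl x)+,
        rule tensor_lift_cong[where M = C and N = C], (assumption | rule cl x)+,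
        rule square_counit_smult_pure) (assumption | rule cl x)+
  also have "\<dots> = tensor_lift CC (\<lambda>a b.
      pure (\<epsilon> b \<odot>\<^bsub>C\<^esub> a) (tensor_lift C (\<lambda>c d. \<epsilon> d \<odot>\<^bsub>C\<^esub> c) (\<Delta> x'))) (\<Delta> x)"
    by (rule tensor_lift_cong[where M = C and N = C], (rule cl x)+,
        rule tensor_lift_linear[where M = C and N = C and P = C, symmetric]) (assumption | rule cl x)+
  also have "\<dots> = tensor_lift CC (\<lambda>a b. pure (\<epsilon> b \<odot>\<^bsub>C\<^esub> a) x') (\<Delta> x)"
    by (simp only: counit_right[OF x(2)])
  also have "\<dots> = pure (tensor_lift C (\<lambda>a b. \<epsilon> b \<odot>\<^bsub>C\<^esub> a) (\<Delta> x)) x'"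
    by (rule tensor_lift_linear[where M = C and N = C and P = C and h = "\<lambda>z. pure z x'", symmetric])
      (assumption | rule cl x)+
  also have "\<dots> = pure x x'"
    by (simp only: counit_right[OF x(1)])
  finally show "?L (pure x x') = pure x x'" .
qed

lemma coalgebra_square: "coalgebra R CC \<Delta>\<^sub>Y \<epsilon>\<^sub>Y"
  by (intro coalgebra.intro coalgebra_axioms.intro module_CC square_comult_linear
      square_counit_linear square_coassoc square_counit_left square_counit_right)

text \<open>The case of \<open>lift_square_comult_pure\<close> in which \<open>G\<close> is the
  universal bilinear map. It serves where the coproduct stands alone and not under a lift.\<close>

lemma square_comult_pure:
  assumes "x \<in> carrier C" "x' \<in> carrier C"
  shows "\<Delta>\<^sub>Y (pure x x') = tensor_lift YY (\<lambda>a b. tensor_lift YY (\<lambda>c d.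
    pure_tensor R CC CC (pure a c) (pure b d)) (\<Delta> x')) (\<Delta> x)"
proof -
  have "\<Delta>\<^sub>Y (pure x x') = tensor_lift YY (pure_tensor R CC CC) (\<Delta>\<^sub>Y (pure x x'))"
    by (rule tensor_lift_pure_tensor[symmetric]) (rule square_comult_closed clin assms)+
  also have "\<dots> = tensor_lift YY (\<lambda>a b. tensor_lift YY (\<lambda>c d.
      pure_tensor R CC CC (pure a c) (pure b d)) (\<Delta> x')) (\<Delta> x)"
    by (rule lift_square_comult_pure[OF _ _ assms]) (assumption | rule clin)+
  finally show ?thesis .
qed

text \<open>Regroups the fourfold coproduct from (1 2)(3 4) to 1((2 3)4). The middle two factors
  then come from a single comultiplication, the position in which the antipode axiom or
  cocommutativity applies.\<close>

lemma coassoc4_lift: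
  assumes P: "module R P" and x: "x \<in> carrier C"
    and F: "\<And>b c d. \<lbrakk>b \<in> carrier C; c \<in> carrier C; d \<in> carrier C\<rbrakk> \<Longrightarrow> (\<lambda>a. F a b c d) \<in> linear_maps R C P"
    "\<And>a c d. \<lbrakk>a \<in> carrier C; c \<in> carrier C; d \<in> carrier C\<rbrakk> \<Longrightarrow> (\<lambda>b. F a b c d) \<in> linear_maps R C P"
    "\<And>a b d. \<lbrakk>a \<in> carrier C; b \<in> carrier C; d \<in> carrier C\<rbrakk> \<Longrightarrow> (\<lambda>c. F a b c d) \<in> linear_maps R C P"
    "\<And>a b c. \<lbrakk>a \<in> carrier C; b \<in> carrier C; c \<in> carrier C\<rbrakk> \<Longrightarrow> (\<lambda>d. F a b c d) \<in> linear_maps R C P"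
  shows "tensor_lift P (\<lambda>p q. tensor_lift P (\<lambda>a b. tensor_lift P (\<lambda>c d. F a b c d) (\<Delta> q)) (\<Delta> p)) (\<Delta> x) =
    tensor_lift P (\<lambda>a q. tensor_lift P (\<lambda>p d. tensor_lift P (\<lambda>b c. F a b c d) (\<Delta> p)) (\<Delta> q)) (\<Delta> x)"
proof -
  note cl = P F linear_mapsD(1)[OF F(4)] x clin
  have "tensor_lift P (\<lambda>p q. tensor_lift P (\<lambda>a b. tensor_lift P (\<lambda>c d. F a b c d) (\<Delta> q)) (\<Delta> p)) (\<Delta> x) =
      tensor_lift P (\<lambda>a q. tensor_lift P (\<lambda>b q. tensor_lift P (\<lambda>c d. F a b c d) (\<Delta> q)) (\<Delta> q)) (\<Delta> x)"
    by (rule coassoc_lift) (assumption | rule cl)+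
  also have "\<dots> =
      tensor_lift P (\<lambda>a q. tensor_lift P (\<lambda>p d. tensor_lift P (\<lambda>b c. F a b c d) (\<Delta> p)) (\<Delta> q)) (\<Delta> x)"
    by (rule tensor_lift_cong[where M = C and N = C], (rule cl)+,
        rule coassoc_lift[symmetric]) (assumption | rule cl)+
  finally show ?thesis .
qed

lemma cocommutative_lift:
  assumes coc: "cocommutative R C \<Delta>" and P: "module R P" and x: "x \<in> carrier C"
    and f: "f \<in> bilinear_maps R C C P"
  shows "tensor_lift P f (\<Delta> x) = tensor_lift P (\<lambda>a b. f b a) (\<Delta> x)"
proof -
  note cl = bilinear_mapsD(3)[OF f] P x linear_mapsD(1)[OF tensor_lift_bilinear[OF f]] clin
  have "tensor_lift P f (\<Delta> x) = tensor_lift P f (tensor_swap R C C (\<Delta> x))"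
    using coc x by (simp add: cocommutative_def)
  also have "\<dots> = tensor_lift P (\<lambda>a b. tensor_lift P f (pure b a)) (\<Delta> x)"
    unfolding tensor_swap_def
    by (rule tensor_lift_lift[OF f]) (assumption | rule cl)+
  also have "\<dots> = tensor_lift P (\<lambda>a b. f b a) (\<Delta> x)"
    by (rule tensor_lift_cong[where M = C and N = C], (rule cl)+, rule tensor_lift_pure[OF f])
      (assumption | rule cl)+
  finally show ?thesis .
qed

text \<open>\<open>coassoc4_lift\<close> puts the second and third factor under one
  comultiplication; cocommutativity exchanges them there, and the regrouping is undone.\<close>

lemma cocommutative_lift4:
  assumes coc: "cocommutative R C \<Delta>" and P: "module R P" and x: "x \<in> carrier C"
    and F: "\<And>b c d. \<lbrakk>b \<in> carrier C; c \<in> carrier C; d \<in> carrier C\<rbrakk> \<Longrightarrow> (\<lambda>a. F a b c d) \<in> linear_maps R C P"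
    "\<And>a c d. \<lbrakk>a \<in> carrier C; c \<in> carrier C; d \<in> carrier C\<rbrakk> \<Longrightarrow> (\<lambda>b. F a b c d) \<in> linear_maps R C P"
    "\<And>a b d. \<lbrakk>a \<in> carrier C; b \<in> carrier C; d \<in> carrier C\<rbrakk> \<Longrightarrow> (\<lambda>c. F a b c d) \<in> linear_maps R C P"
    "\<And>a b c. \<lbrakk>a \<in> carrier C; b \<in> carrier C; c \<in> carrier C\<rbrakk> \<Longrightarrow> (\<lambda>d. F a b c d) \<in> linear_maps R C P"
  shows "tensor_lift P (\<lambda>p q. tensor_lift P (\<lambda>a b. tensor_lift P (\<lambda>c d. F a b c d) (\<Delta> q)) (\<Delta> p)) (\<Delta> x) =
    tensor_lift P (\<lambda>p q. tensor_lift P (\<lambda>a b. tensor_lift P (\<lambda>c d. F a c b d) (\<Delta> q)) (\<Delta> p)) (\<Delta> x)"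
proof -
  note cl = P F linear_mapsD(1)[OF F(4)] x clin
  have "tensor_lift P (\<lambda>p q. tensor_lift P (\<lambda>a b. tensor_lift P (\<lambda>c d. F a b c d) (\<Delta> q)) (\<Delta> p)) (\<Delta> x) =
      tensor_lift P (\<lambda>a q. tensor_lift P (\<lambda>p d. tensor_lift P (\<lambda>b c. F a b c d) (\<Delta> p)) (\<Delta> q)) (\<Delta> x)"
    by (rule coassoc4_lift[OF P x F])
  also have "\<dots> = tensor_lift P (\<lambda>a q. tensor_lift P (\<lambda>p d. tensor_lift P (\<lambda>b c. F a c b d) (\<Delta> p)) (\<Delta> q)) (\<Delta> x)"
    by (rule tensor_lift_cong[where M = C and N = C], (rule cl)+,
        rule tensor_lift_cong[where M = C and N = C], (assumption | rule cl)+,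
        rule cocommutative_lift[OF coc]) (assumption | rule cl)+
  also have "\<dots> = tensor_lift P (\<lambda>p q. tensor_lift P (\<lambda>a b. tensor_lift P (\<lambda>c d. F a c b d) (\<Delta> q)) (\<Delta> p)) (\<Delta> x)"
    by (rule coassoc4_lift[OF P x, symmetric]) (assumption | rule cl)+
  finally show ?thesis .
qed

end

section \<open>Diagonal action and product augmentation\<close>

lemma (in noncomm_algebra) linear_alg_mult_left:
  "\<lbrakk>f \<in> linear_maps R Q A; b \<in> carrier A\<rbrakk> \<Longrightarrow> (\<lambda>x. f x \<otimes>\<^bsub>A\<^esub> b) \<in> linear_maps R Q A"
  by (auto simp: linear_maps_def Pi_iff l_distr smult_mult_left)

lemma (in noncomm_algebra) linear_alg_mult_right:
  "\<lbrakk>f \<in> linear_maps R Q A; a \<in> carrier A\<rbrakk> \<Longrightarrow> (\<lambda>x. a \<otimes>\<^bsub>A\<^esub> f x) \<in> linear_maps R Q A"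
  by (auto simp: linear_maps_def Pi_iff r_distr smult_mult_right)

section \<open>The adjoint action of a Hopf algebra on itself\<close>

context hopf_algebra
begin

lemma antipode_closed: "a \<in> carrier H \<Longrightarrow> S a \<in> carrier H"
  by (rule linear_mapsD(1)[OF antipode_linear])

lemma linear_antipode: "g \<in> linear_maps R Q H \<Longrightarrow> (\<lambda>x. S (g x)) \<in> linear_maps R Q H"
  by (rule linear_maps_compose[OF antipode_linear])

lemma comult_one: "\<Delta>\<^sub>H \<one>\<^bsub>H\<^esub> = pure \<one>\<^bsub>H\<^esub> \<one>\<^bsub>H\<^esub>"
  using ring_hom_one[OF comult_ring_hom] by (simp add: tensor_algebra_def)

lemma comult_mult:
  "\<lbrakk>g \<in> carrier H; h \<in> carrier H\<rbrakk> \<Longrightarrow>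
    \<Delta>\<^sub>H (g \<otimes>\<^bsub>H\<^esub> h) = tensor_map2 R H H (\<otimes>\<^bsub>H\<^esub>) (\<otimes>\<^bsub>H\<^esub>) (\<Delta>\<^sub>H g) (\<Delta>\<^sub>H h)"
  using ring_hom_mult[OF comult_ring_hom, of g h] by (simp add: tensor_algebra_def)

lemmas hlin = linear_alg_mult_left linear_alg_mult_right antipode_closed linear_antipode m_closed clin

text \<open>In Sweedler notation, \<open>S g(1) v g(2) S g(3) w g(4)\<close> collapses to
  \<open>S g(1) v w g(2)\<close> because \<open>g(2) S g(3)\<close> is a counit.\<close>

lemma adjoint_action_mult:
  assumes g: "g \<in> carrier H" and v: "v \<in> carrier H" and w: "w \<in> carrier H"
  shows "tensor_lift H (\<lambda>p q. tensor_lift H (\<lambda>a b. S a \<otimes>\<^bsub>H\<^esub> v \<otimes>\<^bsub>H\<^esub> b) (\<Delta>\<^sub>H p) \<otimes>\<^bsub>H\<^esub>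
      tensor_lift H (\<lambda>c d. S c \<otimes>\<^bsub>H\<^esub> w \<otimes>\<^bsub>H\<^esub> d) (\<Delta>\<^sub>H q)) (\<Delta>\<^sub>H g) =
    tensor_lift H (\<lambda>a b. S a \<otimes>\<^bsub>H\<^esub> (v \<otimes>\<^bsub>H\<^esub> w) \<otimes>\<^bsub>H\<^esub> b) (\<Delta>\<^sub>H g)"
proof -
  note cl = g v w counit_closed smult_closed one_closed hlin
  let ?F = "\<lambda>a b c d. (S a \<otimes>\<^bsub>H\<^esub> v \<otimes>\<^bsub>H\<^esub> b) \<otimes>\<^bsub>H\<^esub> (S c \<otimes>\<^bsub>H\<^esub> w \<otimes>\<^bsub>H\<^esub> d)"
  have "tensor_lift H (\<lambda>p q. tensor_lift H (\<lambda>a b. S a \<otimes>\<^bsub>H\<^esub> v \<otimes>\<^bsub>H\<^esub> b) (\<Delta>\<^sub>H p) \<otimes>\<^bsub>H\<^esub>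
      tensor_lift H (\<lambda>c d. S c \<otimes>\<^bsub>H\<^esub> w \<otimes>\<^bsub>H\<^esub> d) (\<Delta>\<^sub>H q)) (\<Delta>\<^sub>H g) =
    tensor_lift H (\<lambda>p q. tensor_lift H (\<lambda>a b. (S a \<otimes>\<^bsub>H\<^esub> v \<otimes>\<^bsub>H\<^esub> b) \<otimes>\<^bsub>H\<^esub>
      tensor_lift H (\<lambda>c d. S c \<otimes>\<^bsub>H\<^esub> w \<otimes>\<^bsub>H\<^esub> d) (\<Delta>\<^sub>H q)) (\<Delta>\<^sub>H p)) (\<Delta>\<^sub>H g)"
    by (rule tensor_lift_cong[where M = H and N = H], (rule cl)+,
        rule tensor_lift_linear[where M = H and N = H and P = H and
          h = "\<lambda>z. z \<otimes>\<^bsub>H\<^esub> tensor_lift H (\<lambda>c d. S c \<otimes>\<^bsub>H\<^esub> w \<otimes>\<^bsub>H\<^esub> d) (\<Delta>\<^sub>H q)" for q])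
      (assumption | rule cl)+
  also have "\<dots> = tensor_lift H (\<lambda>p q. tensor_lift H (\<lambda>a b. tensor_lift H (\<lambda>c d.
      ?F a b c d) (\<Delta>\<^sub>H q)) (\<Delta>\<^sub>H p)) (\<Delta>\<^sub>H g)"
    by (rule tensor_lift_cong[where M = H and N = H], (rule cl)+,
        rule tensor_lift_cong[where M = H and N = H], (assumption | rule cl)+,
        rule tensor_lift_linear[where M = H and N = H and P = H and
          h = "\<lambda>z. (S a \<otimes>\<^bsub>H\<^esub> v \<otimes>\<^bsub>H\<^esub> b) \<otimes>\<^bsub>H\<^esub> z" for a b])
      (assumption | rule cl)+
  \<comment> \<open>The regrouping brings \<open>b\<close> and \<open>c\<close>, that is g(2) and
    g(3), under one comultiplication, ready for \<open>antipode_right\<close>.\<close>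
  also have "\<dots> = tensor_lift H (\<lambda>a q. tensor_lift H (\<lambda>p d. tensor_lift H (\<lambda>b c.
      ?F a b c d) (\<Delta>\<^sub>H p)) (\<Delta>\<^sub>H q)) (\<Delta>\<^sub>H g)"
    by (rule coassoc4_lift) (assumption | rule cl)+
  also have "\<dots> = tensor_lift H (\<lambda>a q. tensor_lift H (\<lambda>p d.
      (S a \<otimes>\<^bsub>H\<^esub> v \<otimes>\<^bsub>H\<^esub> w) \<otimes>\<^bsub>H\<^esub> (\<epsilon>\<^sub>H p \<odot>\<^bsub>H\<^esub> d)) (\<Delta>\<^sub>H q)) (\<Delta>\<^sub>H g)"
  proof (rule tensor_lift_cong[where M = H and N = H], (rule cl)+,
      rule tensor_lift_cong[where M = H and N = H], (assumption | rule cl)+)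
    fix a q p d assume *: "a \<in> carrier H" "q \<in> carrier H" "p \<in> carrier H" "d \<in> carrier H"
    have "tensor_lift H (\<lambda>b c. ?F a b c d) (\<Delta>\<^sub>H p) =
        tensor_lift H (\<lambda>b c. (S a \<otimes>\<^bsub>H\<^esub> v) \<otimes>\<^bsub>H\<^esub> (b \<otimes>\<^bsub>H\<^esub> S c) \<otimes>\<^bsub>H\<^esub> (w \<otimes>\<^bsub>H\<^esub> d)) (\<Delta>\<^sub>H p)"
      using * by (intro tensor_lift_cong[where R = R and M = H and N = H])
        (simp_all add: m_assoc antipode_closed v w comult_closed module_axioms)
    also have "\<dots> = (S a \<otimes>\<^bsub>H\<^esub> v) \<otimes>\<^bsub>H\<^esub> tensor_lift H (\<lambda>b c. b \<otimes>\<^bsub>H\<^esub> S c) (\<Delta>\<^sub>H p) \<otimes>\<^bsub>H\<^esub> (w \<otimes>\<^bsub>H\<^esub> d)"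
      using * by (intro tensor_lift_linear[symmetric, where M = H and N = H and P = H and
          h = "\<lambda>z. (S a \<otimes>\<^bsub>H\<^esub> v) \<otimes>\<^bsub>H\<^esub> z \<otimes>\<^bsub>H\<^esub> (w \<otimes>\<^bsub>H\<^esub> d)"]) (assumption | rule cl)+
    \<comment> \<open>The middle product is now a scalar multiple of the unit. The scalar is moved
      onto \<open>d\<close>, where the counit axiom will absorb it.\<close>
    also have "\<dots> = (S a \<otimes>\<^bsub>H\<^esub> v \<otimes>\<^bsub>H\<^esub> w) \<otimes>\<^bsub>H\<^esub> (\<epsilon>\<^sub>H p \<odot>\<^bsub>H\<^esub> d)"
      using * v w by (simp add: antipode_right smult_mult_left smult_mult_right m_assoc
          antipode_closed counit_closed)
    finally show "tensor_lift H (\<lambda>b c. ?F a b c d) (\<Delta>\<^sub>H p) =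
        (S a \<otimes>\<^bsub>H\<^esub> v \<otimes>\<^bsub>H\<^esub> w) \<otimes>\<^bsub>H\<^esub> (\<epsilon>\<^sub>H p \<odot>\<^bsub>H\<^esub> d)" .
  qed (assumption | rule cl)+
  also have "\<dots> = tensor_lift H (\<lambda>a q. (S a \<otimes>\<^bsub>H\<^esub> v \<otimes>\<^bsub>H\<^esub> w) \<otimes>\<^bsub>H\<^esub>
      tensor_lift H (\<lambda>p d. \<epsilon>\<^sub>H p \<odot>\<^bsub>H\<^esub> d) (\<Delta>\<^sub>H q)) (\<Delta>\<^sub>H g)"
    by (rule tensor_lift_cong[where M = H and N = H], (rule cl)+,
        rule tensor_lift_linear[symmetric, where M = H and N = H and P = H and
          h = "\<lambda>z. (S a \<otimes>\<^bsub>H\<^esub> v \<otimes>\<^bsub>H\<^esub> w) \<otimes>\<^bsub>H\<^esub> z" for a])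
      (assumption | rule cl)+
  also have "\<dots> = tensor_lift H (\<lambda>a b. S a \<otimes>\<^bsub>H\<^esub> (v \<otimes>\<^bsub>H\<^esub> w) \<otimes>\<^bsub>H\<^esub> b) (\<Delta>\<^sub>H g)"
    by (rule tensor_lift_cong[where R = R and M = H and N = H])
      (simp_all add: g v w counit_left m_assoc antipode_closed comult_closed module_axioms)
  finally show ?thesis .
qed

end

context right_module
begin

lemma act_closed: "\<lbrakk>x \<in> carrier X; g \<in> carrier A\<rbrakk> \<Longrightarrow> act x g \<in> carrier X"
  by (rule linear_mapsD(1)[OF act_linear_right])

lemma linear_act_left:
  "\<lbrakk>f \<in> linear_maps R Q X; g \<in> carrier A\<rbrakk> \<Longrightarrow> (\<lambda>q. act (f q) g) \<in> linear_maps R Q X"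
  by (rule linear_maps_compose[OF act_linear_left])

lemma linear_act_right:
  "\<lbrakk>f \<in> linear_maps R Q A; x \<in> carrier X\<rbrakk> \<Longrightarrow> (\<lambda>q. act x (f q)) \<in> linear_maps R Q X"
  by (rule linear_maps_compose[OF act_linear_right])

end

section \<open>The diagonal action\<close>

context coalgebra_with_action
begin

abbreviation "sact \<equiv> square_act R X \<Delta>\<^sub>H act"

lemmas alin = act_closed linear_act_left linear_act_right hlin
  X.comult_closed X.linear_comult X.module_axioms

lemma square_act_eq: "sact y g = tensor_lift X.CC (\<lambda>x x'. tensor_lift X.CC (\<lambda>c d.
    X.pure (act x c) (act x' d)) (\<Delta>\<^sub>H g)) y"
  by (simp add: square_act_def tensor_map2_def)

lemma linear_square_act_left:
  "\<lbrakk>f \<in> linear_maps R Q X.CC; g \<in> carrier H\<rbrakk> \<Longrightarrow> (\<lambda>y. sact (f y) g) \<in> linear_maps R Q X.CC"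
  unfolding square_act_eq by (assumption | rule alin)+

lemma linear_square_act_right:
  "\<lbrakk>f \<in> linear_maps R Q H; y \<in> carrier X.CC\<rbrakk> \<Longrightarrow> (\<lambda>g. sact y (f g)) \<in> linear_maps R Q X.CC"
  unfolding square_act_eq by (assumption | rule alin)+

lemma square_act_closed: "\<lbrakk>y \<in> carrier X.CC; g \<in> carrier H\<rbrakk> \<Longrightarrow> sact y g \<in> carrier X.CC"
  by (rule linear_mapsD(1)[OF linear_square_act_left[OF linear_maps_ident]])

lemma square_act_pure:
  assumes "x \<in> carrier X" "x' \<in> carrier X" "g \<in> carrier H"
  shows "sact (X.pure x x') g = tensor_lift X.CC (\<lambda>c d. X.pure (act x c) (act x' d)) (\<Delta>\<^sub>H g)"
  unfolding square_act_eq using assms by (intro tensor_lift_pure) (assumption | rule alin)+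

lemma square_act_one:
  assumes y: "y \<in> carrier X.CC"
  shows "sact y \<one>\<^bsub>H\<^esub> = y"
proof (rule tensor_linear_ext[OF X.module_axioms X.module_axioms _ linear_maps_ident y])
  show "(\<lambda>y. sact y \<one>\<^bsub>H\<^esub>) \<in> linear_maps R X.CC X.CC"
    by (rule linear_square_act_left linear_maps_ident one_closed)+
  fix x x' assume x: "x \<in> carrier X" "x' \<in> carrier X"
  have "sact (X.pure x x') \<one>\<^bsub>H\<^esub> = tensor_lift X.CC (\<lambda>c d. X.pure (act x c) (act x' d)) (pure \<one>\<^bsub>H\<^esub> \<one>\<^bsub>H\<^esub>)"
    using x by (simp add: square_act_pure comult_one)
  also have "\<dots> = X.pure (act x \<one>\<^bsub>H\<^esub>) (act x' \<one>\<^bsub>H\<^esub>)"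
    using x by (intro tensor_lift_pure) (assumption | rule alin one_closed)+
  finally show "sact (X.pure x x') \<one>\<^bsub>H\<^esub> = X.pure x x'"
    using x by (simp add: act_one)
qed

text \<open>Comultiplication is an algebra morphism, so the legs of a product are products of legs,
  and \<open>act_mult\<close> applies in each slot.\<close>

lemma square_act_mult:
  assumes y: "y \<in> carrier X.CC" and g: "g \<in> carrier H" and h: "h \<in> carrier H"
  shows "sact y (g \<otimes>\<^bsub>H\<^esub> h) = sact (sact y g) h"
proof (rule tensor_linear_ext[OF X.module_axioms X.module_axioms _ _ y])
  note cl = linear_square_act_left square_act_closed g h alin
  show "(\<lambda>y. sact y (g \<otimes>\<^bsub>H\<^esub> h)) \<in> linear_maps R X.CC X.CC"
    "(\<lambda>y. sact (sact y g) h) \<in> linear_maps R X.CC X.CC"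
    by (rule cl)+
  fix x x' assume x: "x \<in> carrier X" "x' \<in> carrier X"
  let ?f = "\<lambda>c d. X.pure (act x c) (act x' d)"
  have "sact (X.pure x x') (g \<otimes>\<^bsub>H\<^esub> h) = tensor_lift X.CC ?f (\<Delta>\<^sub>H (g \<otimes>\<^bsub>H\<^esub> h))"
    using x g h by (simp add: square_act_pure)
  also have "\<dots> = tensor_lift X.CC (\<lambda>a b. tensor_lift X.CC (\<lambda>c d.
      ?f (a \<otimes>\<^bsub>H\<^esub> c) (b \<otimes>\<^bsub>H\<^esub> d)) (\<Delta>\<^sub>H h)) (\<Delta>\<^sub>H g)"
    unfolding comult_mult[OF g h]
    using x by (intro tensor_lift_map2[where M = H and N = H and M' = H and N' = H and K = H and L = H])
      (assumption | rule cl)+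
  also have "\<dots> = tensor_lift X.CC (\<lambda>a b. tensor_lift X.CC (\<lambda>c d.
      X.pure (act (act x a) c) (act (act x' b) d)) (\<Delta>\<^sub>H h)) (\<Delta>\<^sub>H g)"
  proof (rule tensor_lift_cong[where M = H and N = H], (rule cl)+,
      rule tensor_lift_cong[where M = H and N = H], (assumption | rule cl)+)
    fix a b c d assume "a \<in> carrier H" "b \<in> carrier H" "c \<in> carrier H" "d \<in> carrier H"
    then show "?f (a \<otimes>\<^bsub>H\<^esub> c) (b \<otimes>\<^bsub>H\<^esub> d) = X.pure (act (act x a) c) (act (act x' b) d)"
      using x by (simp add: act_mult)
  qed (assumption | rule cl x)+
  also have "\<dots> = tensor_lift X.CC (\<lambda>a b. sact (X.pure (act x a) (act x' b)) h) (\<Delta>\<^sub>H g)"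
    by (rule tensor_lift_cong[where M = H and N = H], (rule cl)+, rule square_act_pure[symmetric])
      (assumption | rule cl x)+
  also have "\<dots> = sact (tensor_lift X.CC ?f (\<Delta>\<^sub>H g)) h"
    by (rule tensor_lift_linear[where M = H and N = H and P = X.CC and h = "\<lambda>y. sact y h", symmetric])
      (assumption | rule cl x)+
  also have "\<dots> = sact (sact (X.pure x x') g) h"
    using x g by (simp add: square_act_pure)
  finally show "sact (X.pure x x') (g \<otimes>\<^bsub>H\<^esub> h) = sact (sact (X.pure x x') g) h" .
qed

lemma square_coalgebra_with_action:
  "coalgebra_with_action R H \<Delta>\<^sub>H \<epsilon>\<^sub>H S X.CC X.\<Delta>\<^sub>Y X.\<epsilon>\<^sub>Y sact"
proof (intro coalgebra_with_action.intro right_module.intro right_module_axioms.intro)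
  show "(\<lambda>y. sact y g) \<in> linear_maps R X.CC X.CC" if "g \<in> carrier H" for g
    using that by (intro linear_square_act_left linear_maps_ident)
  show "sact y \<in> linear_maps R H X.CC" if "y \<in> carrier X.CC" for y
    using linear_square_act_right[OF linear_maps_ident that] by simp
qed (rule hopf_algebra_axioms noncomm_algebra_axioms X.coalgebra_square X.module_CC square_act_one
      square_act_mult; assumption)+

end

section \<open>The product augmentation\<close>

context augmentation_map
begin

abbreviation "saug \<equiv> square_aug R H \<nu>"

lemma aug_closed: "x \<in> carrier X \<Longrightarrow> \<nu> x \<in> carrier H"
  by (rule linear_mapsD(1)[OF aug_linear])

lemma linear_aug: "g \<in> linear_maps R Q X \<Longrightarrow> (\<lambda>x. \<nu> (g x)) \<in> linear_maps R Q H"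
  by (rule linear_maps_compose[OF aug_linear])

lemmas ulin = aug_closed linear_aug alin

lemma square_aug_eq:
  assumes "y \<in> carrier X.CC"
  shows "saug y = tensor_lift H (\<lambda>x x'. \<nu> x \<otimes>\<^bsub>H\<^esub> \<nu> x') y"
  unfolding square_aug_def
  by (rule tensor_lift_map[where M = X and N = X]) (assumption | rule assms ulin)+

lemma square_aug_linear: "saug \<in> linear_maps R X.CC H"
  unfolding square_aug_def
  by (rule linear_lift_arg[OF linear_tensor_map[OF _ _ _ _ aug_linear aug_linear]])
    (assumption | rule ulin)+

lemma linear_square_aug: "g \<in> linear_maps R Q X.CC \<Longrightarrow> (\<lambda>x. saug (g x)) \<in> linear_maps R Q H"
  by (rule linear_maps_compose[OF square_aug_linear])

lemma square_aug_closed: "y \<in> carrier X.CC \<Longrightarrow> saug y \<in> carrier H"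
  by (rule linear_mapsD(1)[OF square_aug_linear])

lemma square_aug_pure:
  assumes "x \<in> carrier X" "x' \<in> carrier X"
  shows "saug (X.pure x x') = \<nu> x \<otimes>\<^bsub>H\<^esub> \<nu> x'"
proof -
  have "X.pure x x' \<in> carrier X.CC"
    using assms by (intro pure_tensor_closed X.module_axioms)
  then show ?thesis
    using assms by (subst square_aug_eq) (assumption | rule tensor_lift_pure ulin)+
qed

text \<open>The product of H \<otimes> H pairs legs exactly as the middle swap in
  \<open>\<Delta>\<^sub>Y\<close> does: on x \<otimes> x' both sides are the sum of \<nu>(x(1))
  \<nu>(x'(1)) \<otimes> \<nu>(x(2)) \<nu>(x'(2)).\<close>

lemma square_aug_comult:
  assumes y: "y \<in> carrier X.CC"
  shows "\<Delta>\<^sub>H (saug y) = tensor_map R H H saug saug (X.\<Delta>\<^sub>Y y)"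
proof (rule tensor_linear_ext[OF X.module_axioms X.module_axioms _ _ y])
  note cl = linear_square_aug square_aug_closed X.module_CC X.linear_square_comult
    X.square_comult_closed square_aug_linear linear_tensor_map tensor_map_closed ulin
  show "(\<lambda>y. \<Delta>\<^sub>H (saug y)) \<in> linear_maps R X.CC CC"
    by (rule cl)+
  show "(\<lambda>y. tensor_map R H H saug saug (X.\<Delta>\<^sub>Y y)) \<in> linear_maps R X.CC CC"
    by (rule linear_maps_compose[OF linear_tensor_map[where M = X.CC and N = X.CC] X.square_comult_linear])
      (rule X.module_CC module_axioms square_aug_linear)+
  fix x x' assume x: "x \<in> carrier X" "x' \<in> carrier X"
  have "\<Delta>\<^sub>H (saug (X.pure x x')) = tensor_map2 R H H (\<otimes>\<^bsub>H\<^esub>) (\<otimes>\<^bsub>H\<^esub>)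
      (tensor_map R H H \<nu> \<nu> (\<Delta>\<^sub>X x)) (tensor_map R H H \<nu> \<nu> (\<Delta>\<^sub>X x'))"
    using x by (simp add: square_aug_pure comult_mult aug_closed aug_comult)
  also have "\<dots> = tensor_lift CC (\<lambda>a b. tensor_lift CC (\<lambda>c d.
      pure (\<nu> a \<otimes>\<^bsub>H\<^esub> c) (\<nu> b \<otimes>\<^bsub>H\<^esub> d)) (tensor_map R H H \<nu> \<nu> (\<Delta>\<^sub>X x'))) (\<Delta>\<^sub>X x)"
    unfolding tensor_map2_def
    by (rule tensor_lift_map[where M = X and N = X])
      (assumption | rule ulin x tensor_map_closed[where M = X and N = X])+
  also have "\<dots> = tensor_lift CC (\<lambda>a b. tensor_lift CC (\<lambda>c d.
      pure (\<nu> a \<otimes>\<^bsub>H\<^esub> \<nu> c) (\<nu> b \<otimes>\<^bsub>H\<^esub> \<nu> d)) (\<Delta>\<^sub>X x')) (\<Delta>\<^sub>X x)"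
    by (rule tensor_lift_cong[where M = X and N = X], (rule ulin x)+,
        rule tensor_lift_map[where M = X and N = X]) (assumption | rule ulin x)+
  also have "\<dots> = tensor_lift CC (\<lambda>a b. tensor_lift CC (\<lambda>c d.
      pure (saug (X.pure a c)) (saug (X.pure b d))) (\<Delta>\<^sub>X x')) (\<Delta>\<^sub>X x)"
  proof (rule tensor_lift_cong[where M = X and N = X], (rule ulin x)+,
      rule tensor_lift_cong[where M = X and N = X], (assumption | rule ulin x)+)
    fix a b c d assume "a \<in> carrier X" "b \<in> carrier X" "c \<in> carrier X" "d \<in> carrier X"
    then show "pure (\<nu> a \<otimes>\<^bsub>H\<^esub> \<nu> c) (\<nu> b \<otimes>\<^bsub>H\<^esub> \<nu> d) = pure (saug (X.pure a c)) (saug (X.pure b d))"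
      by (simp add: square_aug_pure)
  qed (assumption | rule ulin x square_aug_closed)+
  also have "\<dots> = tensor_map R H H saug saug (X.\<Delta>\<^sub>Y (X.pure x x'))"
    unfolding tensor_map_def
    by (rule X.lift_square_comult_pure[symmetric, OF _ _ x])
      (assumption | rule linear_square_aug square_aug_closed ulin)+
  finally show "\<Delta>\<^sub>H (saug (X.pure x x')) = tensor_map R H H saug saug (X.\<Delta>\<^sub>Y (X.pure x x'))" .
qed

text \<open>\<open>aug_act\<close> says that \<nu> carries the action to the adjoint action of
  \<open>H\<close> on itself. Applied in both factors, it reduces the claim to
  \<open>adjoint_action_mult\<close>, the compatibility of that action with products.\<close>

lemma square_aug_act:
  assumes y: "y \<in> carrier X.CC" and g: "g \<in> carrier H"
  shows "saug (sact y g) = tensor_lift H (\<lambda>a b. S a \<otimes>\<^bsub>H\<^esub> saug y \<otimes>\<^bsub>H\<^esub> b) (\<Delta>\<^sub>H g)"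
proof (rule tensor_linear_ext[OF X.module_axioms X.module_axioms _ _ y])
  note cl = g linear_square_aug square_aug_closed linear_square_act_left ulin
  show "(\<lambda>y. saug (sact y g)) \<in> linear_maps R X.CC H"
    by (rule cl)+
  show "(\<lambda>y. tensor_lift H (\<lambda>a b. S a \<otimes>\<^bsub>H\<^esub> saug y \<otimes>\<^bsub>H\<^esub> b) (\<Delta>\<^sub>H g)) \<in> linear_maps R X.CC H"
    by (assumption | rule cl)+
  fix x x' assume x: "x \<in> carrier X" "x' \<in> carrier X"
  have "saug (sact (X.pure x x') g) =
      saug (tensor_lift X.CC (\<lambda>c d. X.pure (act x c) (act x' d)) (\<Delta>\<^sub>H g))"
    using x g by (simp add: square_act_pure)
  also have "\<dots> = tensor_lift H (\<lambda>c d. saug (X.pure (act x c) (act x' d))) (\<Delta>\<^sub>H g)"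
    by (rule tensor_lift_linear[OF square_aug_linear, where M = H and N = H]) (assumption | rule cl x)+
  also have "\<dots> = tensor_lift H (\<lambda>p q. tensor_lift H (\<lambda>a b. S a \<otimes>\<^bsub>H\<^esub> \<nu> x \<otimes>\<^bsub>H\<^esub> b) (\<Delta>\<^sub>H p) \<otimes>\<^bsub>H\<^esub>
      tensor_lift H (\<lambda>c d. S c \<otimes>\<^bsub>H\<^esub> \<nu> x' \<otimes>\<^bsub>H\<^esub> d) (\<Delta>\<^sub>H q)) (\<Delta>\<^sub>H g)"
  proof (rule tensor_lift_cong[where M = H and N = H])
    fix p q assume "p \<in> carrier H" "q \<in> carrier H"
    then show "saug (X.pure (act x p) (act x' q)) =
        tensor_lift H (\<lambda>a b. S a \<otimes>\<^bsub>H\<^esub> \<nu> x \<otimes>\<^bsub>H\<^esub> b) (\<Delta>\<^sub>H p) \<otimes>\<^bsub>H\<^esub>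
        tensor_lift H (\<lambda>c d. S c \<otimes>\<^bsub>H\<^esub> \<nu> x' \<otimes>\<^bsub>H\<^esub> d) (\<Delta>\<^sub>H q)"
      using x by (simp add: square_aug_pure act_closed aug_act)
  qed (assumption | rule cl x)+
  also have "\<dots> = tensor_lift H (\<lambda>a b. S a \<otimes>\<^bsub>H\<^esub> saug (X.pure x x') \<otimes>\<^bsub>H\<^esub> b) (\<Delta>\<^sub>H g)"
    using x g by (simp add: adjoint_action_mult aug_closed square_aug_pure)
  finally show "saug (sact (X.pure x x') g) =
      tensor_lift H (\<lambda>a b. S a \<otimes>\<^bsub>H\<^esub> saug (X.pure x x') \<otimes>\<^bsub>H\<^esub> b) (\<Delta>\<^sub>H g)" .
qed

lemma square_augmentation_map:
  "augmentation_map R H \<Delta>\<^sub>H \<epsilon>\<^sub>H S X.CC X.\<Delta>\<^sub>Y X.\<epsilon>\<^sub>Y sact saug"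
  by (intro augmentation_map.intro augmentation_map_axioms.intro square_coalgebra_with_action
      square_aug_linear square_aug_comult square_aug_act)

end

section \<open>Compatibility of the diagonal action with the comultiplication\<close>

context categorical_augmented_rack
begin

text \<open>On x \<otimes> x' the left side is the sum of (x(1) g(1) \<otimes> x'(1) g(3)) \<otimes>
  (x(2) g(2) \<otimes> x'(2) g(4)): \<open>g\<close> is first divided between the two factors and
  each share is then comultiplied. The right side comultiplies first and has g(2) and g(3) in
  exchanged places.\<close>

lemma square_act_compatible:
  assumes coc: "cocommutative R H \<Delta>\<^sub>H" and y: "y \<in> carrier X.CC" and g: "g \<in> carrier H"
  shows "X.\<Delta>\<^sub>Y (sact y g) = tensor_map2 R X.CC X.CC sact sact (X.\<Delta>\<^sub>Y y) (\<Delta>\<^sub>H g)"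
proof (rule tensor_linear_ext[OF X.module_axioms X.module_axioms _ _ y])
  note cl = g linear_square_act_left linear_square_act_right square_act_closed X.module_CC
    X.linear_square_comult X.square_comult_closed alin
  let ?YY = "X.YY" and ?p = "pure_tensor R X.CC X.CC"
  let ?K = "\<lambda>a b c d p p' q q'. ?p (X.pure (act a p) (act c q)) (X.pure (act b p') (act d q'))"
  show "(\<lambda>y. X.\<Delta>\<^sub>Y (sact y g)) \<in> linear_maps R X.CC ?YY"
    by (rule cl)+
  show "(\<lambda>y. tensor_map2 R X.CC X.CC sact sact (X.\<Delta>\<^sub>Y y) (\<Delta>\<^sub>H g)) \<in> linear_maps R X.CC ?YY"
    unfolding tensor_map2_def by (assumption | rule cl)+
  fix x x' assume x: "x \<in> carrier X" "x' \<in> carrier X"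
  have "X.\<Delta>\<^sub>Y (sact (X.pure x x') g) =
      X.\<Delta>\<^sub>Y (tensor_lift X.CC (\<lambda>p q. X.pure (act x p) (act x' q)) (\<Delta>\<^sub>H g))"
    using x g by (simp add: square_act_pure)
  also have "\<dots> = tensor_lift ?YY (\<lambda>p q. X.\<Delta>\<^sub>Y (X.pure (act x p) (act x' q))) (\<Delta>\<^sub>H g)"
    by (rule tensor_lift_linear[OF X.square_comult_linear, where M = H and N = H])
      (assumption | rule cl x)+
  also have "\<dots> = tensor_lift ?YY (\<lambda>p q. tensor_lift ?YY (\<lambda>a b. tensor_lift ?YY (\<lambda>c d.
      tensor_lift ?YY (\<lambda>p p'. tensor_lift ?YY (\<lambda>q q'. ?K a b c d p p' q q')
      (\<Delta>\<^sub>H q)) (\<Delta>\<^sub>H p)) (\<Delta>\<^sub>X x')) (\<Delta>\<^sub>X x)) (\<Delta>\<^sub>H g)"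
  proof (rule tensor_lift_cong[where M = H and N = H])
    fix p q assume pq: "p \<in> carrier H" "q \<in> carrier H"
    have "X.\<Delta>\<^sub>Y (X.pure (act x p) (act x' q)) = tensor_lift ?YY (\<lambda>a b. tensor_lift ?YY (\<lambda>c d.
        ?p (X.pure a c) (X.pure b d)) (tensor_map2 R X X act act (\<Delta>\<^sub>X x') (\<Delta>\<^sub>H q)))
        (tensor_map2 R X X act act (\<Delta>\<^sub>X x) (\<Delta>\<^sub>H p))"
      using x pq by (simp add: X.square_comult_pure act_closed act_compatible)
    also have "\<dots> = tensor_lift ?YY (\<lambda>a b. tensor_lift ?YY (\<lambda>p p'. tensor_lift ?YY (\<lambda>c d.
        ?p (X.pure (act a p) c) (X.pure (act b p') d)) (tensor_map2 R X X act act (\<Delta>\<^sub>X x') (\<Delta>\<^sub>H q)))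
        (\<Delta>\<^sub>H p)) (\<Delta>\<^sub>X x)"
      by (rule tensor_lift_map2[where M = X and N = X and M' = H and N' = H])
        (assumption | rule tensor_map2_closed[where M = X and N = X and M' = H and N' = H] cl x pq)+
    also have "\<dots> = tensor_lift ?YY (\<lambda>a b. tensor_lift ?YY (\<lambda>p p'. tensor_lift ?YY (\<lambda>c d.
        tensor_lift ?YY (\<lambda>q q'. ?K a b c d p p' q q') (\<Delta>\<^sub>H q)) (\<Delta>\<^sub>X x')) (\<Delta>\<^sub>H p)) (\<Delta>\<^sub>X x)"
      by (rule tensor_lift_cong[where M = X and N = X], (rule cl x pq)+,
          rule tensor_lift_cong[where M = H and N = H], (assumption | rule cl x pq)+,
          rule tensor_lift_map2[where M = X and N = X and M' = H and N' = H])
        (assumption | rule cl x pq)+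
    also have "\<dots> = tensor_lift ?YY (\<lambda>a b. tensor_lift ?YY (\<lambda>c d. tensor_lift ?YY (\<lambda>p p'.
        tensor_lift ?YY (\<lambda>q q'. ?K a b c d p p' q q') (\<Delta>\<^sub>H q)) (\<Delta>\<^sub>H p)) (\<Delta>\<^sub>X x')) (\<Delta>\<^sub>X x)"
      by (rule tensor_lift_cong[where M = X and N = X], (rule cl x pq)+,
          rule tensor_lift_swap[where M = H and N = H and M' = X and N' = X])
        (assumption | rule cl x pq)+
    finally show "X.\<Delta>\<^sub>Y (X.pure (act x p) (act x' q)) = \<dots>" .
  qed (assumption | rule cl x)+
  \<comment> \<open>The sums over \<open>g\<close> move inside those over \<open>x\<close> and
    \<open>x'\<close>, so that the fourfold coproduct of \<open>g\<close> stands alone for fixed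
    \<open>a\<close>, \<open>b\<close>, \<open>c\<close>, \<open>d\<close>.\<close>
  also have "\<dots> = tensor_lift ?YY (\<lambda>a b. tensor_lift ?YY (\<lambda>p q. tensor_lift ?YY (\<lambda>c d.
      tensor_lift ?YY (\<lambda>p p'. tensor_lift ?YY (\<lambda>q q'. ?K a b c d p p' q q')
      (\<Delta>\<^sub>H q)) (\<Delta>\<^sub>H p)) (\<Delta>\<^sub>X x')) (\<Delta>\<^sub>H g)) (\<Delta>\<^sub>X x)"
    by (rule tensor_lift_swap[where M = H and N = H and M' = X and N' = X]) (assumption | rule cl x)+
  also have "\<dots> = tensor_lift ?YY (\<lambda>a b. tensor_lift ?YY (\<lambda>c d. tensor_lift ?YY (\<lambda>p q.
      tensor_lift ?YY (\<lambda>p p'. tensor_lift ?YY (\<lambda>q q'. ?K a b c d p p' q q')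
      (\<Delta>\<^sub>H q)) (\<Delta>\<^sub>H p)) (\<Delta>\<^sub>H g)) (\<Delta>\<^sub>X x')) (\<Delta>\<^sub>X x)"
    by (rule tensor_lift_cong[where M = X and N = X], (rule cl x)+,
        rule tensor_lift_swap[where M = H and N = H and M' = X and N' = X]) (assumption | rule cl x)+
  \<comment> \<open>The exchange of g(2) and g(3) is visible in the last four arguments of
    \<open>?K\<close>.\<close>
  also have "\<dots> = tensor_lift ?YY (\<lambda>a b. tensor_lift ?YY (\<lambda>c d. tensor_lift ?YY (\<lambda>p q.
      tensor_lift ?YY (\<lambda>p p'. tensor_lift ?YY (\<lambda>q q'. ?K a b c d p q p' q')
      (\<Delta>\<^sub>H q)) (\<Delta>\<^sub>H p)) (\<Delta>\<^sub>H g)) (\<Delta>\<^sub>X x')) (\<Delta>\<^sub>X x)"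
    by (rule tensor_lift_cong[where M = X and N = X], (rule cl x)+,
        rule tensor_lift_cong[where M = X and N = X], (assumption | rule cl x)+,
        rule cocommutative_lift4[OF coc]) (assumption | rule cl x)+
  \<comment> \<open>The legs of \<open>p\<close> now occur only in the first slot and those of
    \<open>q\<close> only in the second, so the double sum factors into two diagonal
    actions.\<close>
  also have "\<dots> = tensor_lift ?YY (\<lambda>a b. tensor_lift ?YY (\<lambda>c d. tensor_lift ?YY (\<lambda>p q.
      ?p (sact (X.pure a c) p) (sact (X.pure b d) q)) (\<Delta>\<^sub>H g)) (\<Delta>\<^sub>X x')) (\<Delta>\<^sub>X x)"
  proof (rule tensor_lift_cong[where M = X and N = X], (rule cl x)+,
      rule tensor_lift_cong[where M = X and N = X], (assumption | rule cl x)+,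
      rule tensor_lift_cong[where M = H and N = H], (assumption | rule cl x)+)
    fix a b c d p q
    assume *: "a \<in> carrier X" "b \<in> carrier X" "c \<in> carrier X" "d \<in> carrier X"
      "p \<in> carrier H" "q \<in> carrier H"
    let ?t = "tensor_lift X.CC (\<lambda>q q'. X.pure (act b q) (act d q')) (\<Delta>\<^sub>H q)"
    have "tensor_lift ?YY (\<lambda>p p'. tensor_lift ?YY (\<lambda>q q'. ?K a b c d p q p' q') (\<Delta>\<^sub>H q)) (\<Delta>\<^sub>H p) =
        tensor_lift ?YY (\<lambda>p p'. ?p (X.pure (act a p) (act c p')) ?t) (\<Delta>\<^sub>H p)"
      using * by - (rule tensor_lift_cong[where M = H and N = H], (assumption | rule cl)+,
          rule tensor_lift_linear[where M = H and N = H and P = X.CC, symmetric],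
          (assumption | rule cl)+)
    also have "\<dots> = ?p (tensor_lift X.CC (\<lambda>p p'. X.pure (act a p) (act c p')) (\<Delta>\<^sub>H p)) ?t"
      using * by - (rule tensor_lift_linear[where M = H and N = H and P = X.CC and
          h = "\<lambda>s. ?p s ?t", symmetric], (assumption | rule cl)+)
    also have "\<dots> = ?p (sact (X.pure a c) p) (sact (X.pure b d) q)"
      using * by (simp add: square_act_pure)
    finally show "tensor_lift ?YY (\<lambda>p p'. tensor_lift ?YY (\<lambda>q q'. ?K a b c d p q p' q')
        (\<Delta>\<^sub>H q)) (\<Delta>\<^sub>H p) = ?p (sact (X.pure a c) p) (sact (X.pure b d) q)" .
  qed (assumption | rule cl x)+
  also have "\<dots> = tensor_map2 R X.CC X.CC sact sact (X.\<Delta>\<^sub>Y (X.pure x x')) (\<Delta>\<^sub>H g)"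
    unfolding tensor_map2_def
    by (rule X.lift_square_comult_pure[symmetric, OF _ _ x]) (assumption | rule cl x)+
  finally show "X.\<Delta>\<^sub>Y (sact (X.pure x x') g) =
      tensor_map2 R X.CC X.CC sact sact (X.\<Delta>\<^sub>Y (X.pure x x')) (\<Delta>\<^sub>H g)" .
qed

lemma square_categorical_augmented_rack:
  assumes "cocommutative R H \<Delta>\<^sub>H"
  shows "categorical_augmented_rack R H \<Delta>\<^sub>H \<epsilon>\<^sub>H S X.CC X.\<Delta>\<^sub>Y X.\<epsilon>\<^sub>Y sact saug"
  by (intro categorical_augmented_rack.intro categorical_augmented_rack_axioms.intro
      square_augmentation_map square_act_compatible assms)

end

text \<open>The second conjunct is conditional because the diagonal action can fail to be compatible
  with the comultiplication. Take \<open>X\<close> to be \<open>H\<close> with right multiplication,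
  a categorical augmented rack whose augmentation sends h to \<epsilon>(h) times the unit. At 1
  \<otimes> 1, compatibility equates g(1) \<otimes> g(3) \<otimes> g(2) \<otimes> g(4) with g(1)
  \<otimes> g(2) \<otimes> g(3) \<otimes> g(4), and the counit applied to the outer factors leaves
  cocommutativity.\<close>

theorem theorem6p1:
  fixes R :: "'k ring"
    and H :: "('k, 'h) module" and \<Delta>\<^sub>H :: "'h \<Rightarrow> ('h, 'h) tensor" and \<epsilon>\<^sub>H :: "'h \<Rightarrow> 'k"
    and S :: "'h \<Rightarrow> 'h"
    and X :: "('k, 'x) module" and \<Delta>\<^sub>X :: "'x \<Rightarrow> ('x, 'x) tensor" and \<epsilon>\<^sub>X :: "'x \<Rightarrow> 'k"
    and act :: "'x \<Rightarrow> 'h \<Rightarrow> 'x" and \<nu> :: "'x \<Rightarrow> 'h"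
  assumes "categorical_augmented_rack R H \<Delta>\<^sub>H \<epsilon>\<^sub>H S X \<Delta>\<^sub>X \<epsilon>\<^sub>X act \<nu>"
  shows "augmentation_map R H \<Delta>\<^sub>H \<epsilon>\<^sub>H S
      (tensor_module R X X) (square_comult R X \<Delta>\<^sub>X) (square_counit R \<epsilon>\<^sub>X)
      (square_act R X \<Delta>\<^sub>H act) (square_aug R H \<nu>) \<and>
    (cocommutative R H \<Delta>\<^sub>H \<longrightarrow>
      categorical_augmented_rack R H \<Delta>\<^sub>H \<epsilon>\<^sub>H S
        (tensor_module R X X) (square_comult R X \<Delta>\<^sub>X) (square_counit R \<epsilon>\<^sub>X)
        (square_act R X \<Delta>\<^sub>H act) (square_aug R H \<nu>))"
proof -
  interpret categorical_augmented_rack R H \<Delta>\<^sub>H \<epsilon>\<^sub>H S X \<Delta>\<^sub>X \<epsilon>\<^sub>X act \<nu>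
    by fact
  show ?thesis
    using square_augmentation_map square_categorical_augmented_rack by blast
qed

end
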